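(* Let $\psi:\mathbb R\to\mathbb R$ be a non-decreasing function such that $-\log(1-x+x^2/2)\leq \psi(x)\leq \log(1+x+x^2/2)$ for all $x\in\mathbb R$. Let $Y_1,\ldots,Y_n\in \mathbb C^{d\times d}$ be independent self-adjoint random matrices whose entries have finite second moments, and let $\sigma_n^2\geq\big\| \sum_{j=1}^n \mathbb EY_j^2 \big\|$. Then for all $\theta>0$ and all $t>0$, \[ \Pr\Big( \Big\| \sum_{j=1}^n \Big(\frac{1}{\theta}\psi( \theta Y_j ) - \mathbb EY_j \Big) \Big\| \geq t\sqrt n \Big) \leq 2d \exp\Big( -\theta t\sqrt{n} + \frac{\theta^2\sigma_n^2}{2} \Big). \] In particular, for a given $t>0$, choosing $\theta=\frac{t\sqrt{n}}{\sigma_n^2}$ yields the bound $2d \exp\big( -\frac{t^2}{2\sigma_n^2/n} \big)$; and choosing $\theta=\frac{\sqrt{n}}{\sigma_n^2}$ yields the bound $2d \exp\big( -\frac{2t-1}{2\sigma_n^2/n} \big)$ for all $t>1/2$.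
   Context: $\|\cdot\|$ is the operator norm. For a real function $f$ and a self-adjoint matrix $A=U\,\mathrm{diag}(\lambda_1,\ldots,\lambda_d)\,U^\ast$, $f(A):=U\,\mathrm{diag}(f(\lambda_1),\ldots,f(\lambda_d))\,U^\ast$. Expectations of random matrices are taken entrywise. *)

theory Defs
  imports "HOL-Probability.Probability"
begin

definition cmat_adj :: "complex^'n^'n \<Rightarrow> complex^'n^'n" where
  "cmat_adj A = (\<chi> i j. cnj (A $ j $ i))"

definition self_adjoint :: "complex^'n^'n \<Rightarrow> bool" where
  "self_adjoint A \<longleftrightarrow> cmat_adj A = A"

definition unitary_mat :: "complex^'n^'n \<Rightarrow> bool" where
  "unitary_mat U \<longleftrightarrow> U ** cmat_adj U = mat 1 \<and> cmat_adj U ** U = mat 1"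

definition real_diag :: "('n \<Rightarrow> real) \<Rightarrow> complex^'n^'n" where
  "real_diag l = (\<chi> i j. if i = j then complex_of_real (l i) else 0)"

text \<open>Functional calculus: for self-adjoint A = U diag(l) U*, f(A) = U diag(f o l) U*
  (independent of the chosen decomposition).\<close>
definition matfun :: "(real \<Rightarrow> real) \<Rightarrow> complex^'n^'n \<Rightarrow> complex^'n^'n" where
  "matfun f A = (SOME B. \<exists>U l. unitary_mat U \<and> A = U ** real_diag l ** cmat_adj U
                              \<and> B = U ** real_diag (f \<circ> l) ** cmat_adj U)"

definition opnorm :: "complex^'n^'n \<Rightarrow> real" where
  "opnorm A = onorm (\<lambda>x::complex^'n. A *v x)"

definition mat_expect :: "'a measure \<Rightarrow> ('a \<Rightarrow> complex^'n^'n) \<Rightarrow> complex^'n^'n" where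
  "mat_expect M X = (\<chi> i j. integral\<^sup>L M (\<lambda>w. X w $ i $ j))"

end

theory Submission
  imports Defs
begin

text \<open>The Laplace transform method: the event forces \<open>tr exp (\<plusminus> \<theta> S) \<ge> exp (\<theta> t \<surd>n)\<close> for one of the signs,
  where \<open>S\<close> is the centred sum. The two-sided bound on \<open>\<psi>\<close> gives \<open>\<psi>(\<theta> Y) \<le> ln (1 + \<theta> Y + \<theta>\<^sup>2 Y\<^sup>2 / 2)\<close> and
  the analogue for \<open>-\<theta>\<close>, and since \<open>tr exp\<close> is monotone, \<open>\<psi>\<close> may be replaced by these logarithms,
  which are continuous and hence measurable. Lieb's concavity of \<open>Z \<mapsto> tr exp (H + ln Z)\<close>, applied
  to one independent summand after the other, moves the expectation inside the logarithm, and
  \<open>ln Z \<le> Z - 1\<close> leaves \<open>tr exp (\<theta>\<^sup>2/2 \<cdot> \<Sum>E Y\<^sup>2) \<le> d exp (\<theta>\<^sup>2 \<sigma>\<^sup>2 / 2)\<close>.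

  Lieb's theorem follows from the Gibbs variational principle and the joint convexity of the
  relative entropy \<open>tr (A ln A - A ln B)\<close>. The latter comes from
  \<open>a ln (a/b) - a + b = \<integral>\<^sub>0\<^sup>1 u (a - b)\<^sup>2 / ((1 - u) a + u b) du\<close>, whose integrand becomes a supremum of
  functions linear in \<open>(A, B)\<close>. The real inner product on matrices is \<open>X \<bullet> Y = Re tr (X\<^sup>* Y)\<close>;
  in particular \<open>mat 1 \<bullet> A\<close> is the real part of the trace.\<close>

section \<open>Spectral calculus for self-adjoint matrices\<close>

lemma matrix_mult_nth: "(A ** B) $ i $ j = (\<Sum>k\<in>UNIV. A $ i $ k * B $ k $ j)"
  by (simp add: matrix_matrix_mult_def)

lemma cmat_adj_nth [simp]: "cmat_adj A $ i $ j = cnj (A $ j $ i)"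
  by (simp add: cmat_adj_def)

lemma cmat_adj_cmat_adj [simp]: "cmat_adj (cmat_adj A) = A"
  by (simp add: vec_eq_iff)

lemma cmat_adj_add: "cmat_adj (A + B) = cmat_adj A + cmat_adj B"
  by (simp add: vec_eq_iff)

lemma cmat_adj_scaleR: "cmat_adj (c *\<^sub>R A) = c *\<^sub>R cmat_adj A"
  by (simp add: vec_eq_iff)

lemma cmat_adj_mult: "cmat_adj (A ** B) = cmat_adj B ** cmat_adj A"
  by (simp add: vec_eq_iff matrix_mult_nth mult.commute)

lemma self_adjoint_iff: "self_adjoint A \<longleftrightarrow> (\<forall>i j. cnj (A $ i $ j) = A $ j $ i)"
  by (auto simp: self_adjoint_def vec_eq_iff)

lemma self_adjoint_add: "self_adjoint A \<Longrightarrow> self_adjoint B \<Longrightarrow> self_adjoint (A + B)"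
  by (simp add: self_adjoint_iff)

lemma self_adjoint_diff: "self_adjoint A \<Longrightarrow> self_adjoint B \<Longrightarrow> self_adjoint (A - B)"
  by (simp add: self_adjoint_iff)

lemma self_adjoint_scaleR: "self_adjoint A \<Longrightarrow> self_adjoint (c *\<^sub>R A)"
  by (simp add: self_adjoint_iff)

lemma self_adjoint_mat_1: "self_adjoint (mat 1)"
  by (simp add: self_adjoint_iff mat_def)

lemma self_adjoint_sum: "(\<And>i. i \<in> I \<Longrightarrow> self_adjoint (f i)) \<Longrightarrow> self_adjoint (sum f I)"
  by (induction I rule: infinite_finite_induct)
     (auto simp: self_adjoint_add self_adjoint_iff)

lemma self_adjoint_square: "self_adjoint A \<Longrightarrow> self_adjoint (A ** A)"
  by (simp add: self_adjoint_def cmat_adj_mult)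

lemma inner_complex_vec: "(x :: complex^'n) \<bullet> y = Re (\<Sum>i\<in>UNIV. cnj (x $ i) * y $ i)"
  by (simp add: inner_vec_def inner_complex_def)

lemma inner_complex_mat:
  "(X :: complex^'n^'m) \<bullet> Y = Re (\<Sum>i\<in>UNIV. \<Sum>j\<in>UNIV. cnj (X $ i $ j) * Y $ i $ j)"
  by (simp add: inner_vec_def inner_complex_def)

lemma inner_mult_vec:
  fixes A :: "complex^'n^'n"
  shows "(A *v x) \<bullet> y = x \<bullet> (cmat_adj A *v y)"
proof -
  have "(\<Sum>i\<in>UNIV. cnj ((A *v x) $ i) * y $ i) = (\<Sum>i\<in>UNIV. \<Sum>k\<in>UNIV. cnj (A $ i $ k) * cnj (x $ k) * y $ i)"
    by (simp add: matrix_vector_mult_def sum_distrib_right)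
  also have "\<dots> = (\<Sum>k\<in>UNIV. \<Sum>i\<in>UNIV. cnj (A $ i $ k) * cnj (x $ k) * y $ i)"
    by (rule sum.swap)
  also have "\<dots> = (\<Sum>k\<in>UNIV. cnj (x $ k) * (cmat_adj A *v y) $ k)"
    by (simp add: matrix_vector_mult_def sum_distrib_left mult_ac)
  finally show ?thesis
    unfolding inner_complex_vec by simp
qed

lemma inner_mult_left:
  fixes A X Y :: "complex^'n^'n"
  shows "(A ** X) \<bullet> Y = X \<bullet> (cmat_adj A ** Y)"
proof -
  have "(\<Sum>i\<in>UNIV. \<Sum>j\<in>UNIV. cnj ((A ** X) $ i $ j) * Y $ i $ j)
      = (\<Sum>j\<in>UNIV. \<Sum>i\<in>UNIV. \<Sum>k\<in>UNIV. cnj (A $ i $ k) * cnj (X $ k $ j) * Y $ i $ j)"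
    by (subst sum.swap) (simp add: matrix_mult_nth sum_distrib_right)
  also have "\<dots> = (\<Sum>j\<in>UNIV. \<Sum>k\<in>UNIV. \<Sum>i\<in>UNIV. cnj (A $ i $ k) * cnj (X $ k $ j) * Y $ i $ j)"
    by (intro sum.cong refl sum.swap)
  also have "\<dots> = (\<Sum>k\<in>UNIV. \<Sum>j\<in>UNIV. cnj (X $ k $ j) * (cmat_adj A ** Y) $ k $ j)"
    by (subst sum.swap) (simp add: matrix_mult_nth sum_distrib_left mult_ac)
  finally show ?thesis
    unfolding inner_complex_mat by simp
qed

text \<open>Taking adjoints conjugates the complex sum, which leaves its real part unchanged. This
  turns facts about multiplication from the left into facts about multiplication from the
  right.\<close>

lemma inner_cmat_adj: "cmat_adj X \<bullet> cmat_adj Y = X \<bullet> Y"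
proof -
  have "(\<Sum>i\<in>UNIV. \<Sum>j\<in>UNIV. cnj (cmat_adj X $ i $ j) * cmat_adj Y $ i $ j)
      = cnj (\<Sum>i\<in>UNIV. \<Sum>j\<in>UNIV. cnj (X $ i $ j) * Y $ i $ j)"
    by (subst sum.swap) simp
  then show ?thesis
    unfolding inner_complex_mat by simp
qed

lemma inner_mult_right:
  fixes A X Y :: "complex^'n^'n"
  shows "(X ** A) \<bullet> Y = X \<bullet> (Y ** cmat_adj A)"
proof -
  have "(X ** A) \<bullet> Y = (cmat_adj A ** cmat_adj X) \<bullet> cmat_adj Y"
    by (metis inner_cmat_adj cmat_adj_mult)
  also have "\<dots> = X \<bullet> (Y ** cmat_adj A)"
    by (metis inner_cmat_adj inner_mult_left cmat_adj_mult cmat_adj_cmat_adj)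
  finally show ?thesis .
qed

text \<open>Matrices sharing one \<open>U\<close> are computed with as families of eigenvalues.
  \<open>U\<close> is arbitrary here: identities linear in \<open>l\<close> hold for every
  \<open>U\<close>, whereas the unit, products and functional calculus are treated for unitary
  \<open>U\<close>.\<close>

definition cdiag :: "complex^'n^'n \<Rightarrow> ('n \<Rightarrow> real) \<Rightarrow> complex^'n^'n" where
  "cdiag U l = U ** real_diag l ** cmat_adj U"

lemma real_diag_mult_nth: "(real_diag l ** A) $ i $ j = of_real (l i) * A $ i $ j"
proof -
  have "(real_diag l ** A) $ i $ j = (\<Sum>k\<in>UNIV. if i = k then of_real (l i) * A $ k $ j else 0)"
    by (simp add: matrix_mult_nth real_diag_def if_distrib[of "\<lambda>x. x * _"] cong: if_cong)
  then show ?thesis by simp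
qed

lemma mult_real_diag_nth: "(A ** real_diag l) $ i $ j = of_real (l j) * A $ i $ j"
proof -
  have "(A ** real_diag l) $ i $ j = (\<Sum>k\<in>UNIV. if k = j then A $ i $ k * of_real (l k) else 0)"
    by (simp add: matrix_mult_nth real_diag_def if_distrib[of "\<lambda>x. _ * x"] cong: if_cong)
  then show ?thesis by (simp add: mult.commute)
qed

lemma cdiag_nth: "cdiag U l $ i $ j = (\<Sum>k\<in>UNIV. of_real (l k) * (U $ i $ k * cnj (U $ j $ k)))"
  by (simp add: cdiag_def matrix_mult_nth[of "U ** _"] mult_real_diag_nth mult_ac)

lemma self_adjoint_cdiag: "self_adjoint (cdiag U l)"
  by (simp add: self_adjoint_iff cdiag_nth mult_ac)

lemma cdiag_add: "cdiag U l + cdiag U m = cdiag U (\<lambda>i. l i + m i)"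
  by (simp add: vec_eq_iff cdiag_nth sum.distrib algebra_simps)

lemma cdiag_diff: "cdiag U l - cdiag U m = cdiag U (\<lambda>i. l i - m i)"
  by (simp add: vec_eq_iff cdiag_nth sum_subtractf algebra_simps)

lemma cdiag_scaleR: "c *\<^sub>R cdiag U l = cdiag U (\<lambda>i. c * l i)"
  by (simp add: vec_eq_iff cdiag_nth sum_distrib_left scaleR_conv_of_real[where 'a=complex] mult_ac)

lemma real_diag_1: "real_diag (\<lambda>_. 1) = mat 1"
  by (simp add: vec_eq_iff real_diag_def mat_def)

lemma cdiag_1: "unitary_mat U \<Longrightarrow> cdiag U (\<lambda>_. 1) = mat 1"
  by (simp add: cdiag_def real_diag_1 unitary_mat_def)

lemma cdiag_mult:
  assumes "unitary_mat U"
  shows "cdiag U l ** cdiag U m = cdiag U (\<lambda>i. l i * m i)"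
proof -
  have "cdiag U l ** cdiag U m = U ** (real_diag l ** ((cmat_adj U ** U) ** real_diag m)) ** cmat_adj U"
    by (simp add: cdiag_def matrix_mul_assoc)
  also have "\<dots> = U ** (real_diag l ** real_diag m) ** cmat_adj U"
    using assms by (simp add: unitary_mat_def)
  also have "real_diag l ** real_diag m = real_diag (\<lambda>i. l i * m i)"
    unfolding vec_eq_iff real_diag_mult_nth by (simp add: real_diag_def)
  finally show ?thesis by (simp add: cdiag_def)
qed

lemma unitary_mat_adj_mult:
  assumes "unitary_mat U" "unitary_mat V"
  shows "unitary_mat (cmat_adj U ** V)"
proof -
  have "cmat_adj U ** V ** cmat_adj (cmat_adj U ** V) = cmat_adj U ** (V ** cmat_adj V) ** U"
       "cmat_adj (cmat_adj U ** V) ** (cmat_adj U ** V) = cmat_adj V ** (U ** cmat_adj U) ** V"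
    by (simp_all add: cmat_adj_mult matrix_mul_assoc)
  with assms show ?thesis by (simp add: unitary_mat_def)
qed

lemma unitary_row_sum:
  assumes "unitary_mat W"
  shows "(\<Sum>j\<in>UNIV. (cmod (W $ i $ j))\<^sup>2) = 1"
proof -
  have "of_real (\<Sum>j\<in>UNIV. (cmod (W $ i $ j))\<^sup>2) = (W ** cmat_adj W) $ i $ i"
    by (simp add: matrix_mult_nth complex_norm_square del: of_real_power)
  also have "\<dots> = of_real 1" using assms by (simp add: unitary_mat_def mat_def)
  finally show ?thesis unfolding of_real_eq_iff .
qed

lemma unitary_col_sum:
  assumes "unitary_mat W"
  shows "(\<Sum>i\<in>UNIV. (cmod (W $ i $ j))\<^sup>2) = 1"
proof -
  have "of_real (\<Sum>i\<in>UNIV. (cmod (W $ i $ j))\<^sup>2) = (cmat_adj W ** W) $ j $ j"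
    by (simp add: matrix_mult_nth complex_norm_square mult.commute del: of_real_power)
  also have "\<dots> = of_real 1" using assms by (simp add: unitary_mat_def mat_def)
  finally show ?thesis unfolding of_real_eq_iff .
qed

text \<open>For unitary \<open>U\<close> and \<open>V\<close> the weights
  \<open>(cmod (W $ i $ j))\<^sup>2\<close> with \<open>W = cmat_adj U ** V\<close> have row and
  column sums 1. Trace inequalities for two matrices that need not commute thereby reduce to scalar
  inequalities between eigenvalues.\<close>

lemma inner_cdiag:
  "cdiag U a \<bullet> cdiag V b
   = (\<Sum>i\<in>UNIV. \<Sum>j\<in>UNIV. (cmod ((cmat_adj U ** V) $ i $ j))\<^sup>2 * (a i * b j))"
proof -
  let ?W = "cmat_adj U ** V"
  have "cdiag U a \<bullet> cdiag V b = (real_diag a ** cmat_adj U) \<bullet> (cmat_adj U ** V ** real_diag b ** cmat_adj V)"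
    by (simp add: cdiag_def inner_mult_left flip: matrix_mul_assoc)
  also have "\<dots> = (real_diag a ** ?W) \<bullet> (?W ** real_diag b)"
    using inner_mult_right[of "?W ** real_diag b" "cmat_adj V" "real_diag a ** cmat_adj U"]
    by (simp add: inner_commute matrix_mul_assoc)
  also have "\<dots> = Re (\<Sum>i\<in>UNIV. \<Sum>j\<in>UNIV. of_real ((cmod (?W $ i $ j))\<^sup>2 * (a i * b j)))"
    unfolding inner_complex_mat real_diag_mult_nth mult_real_diag_nth
    by (simp add: complex_norm_square mult_ac del: of_real_power)
  finally show ?thesis by simp
qed

lemma inner_cdiag_same:
  assumes "unitary_mat U"
  shows "cdiag U a \<bullet> cdiag U b = (\<Sum>i\<in>UNIV. a i * b i)"
proof -
  have "cdiag U a \<bullet> cdiag U b = (\<Sum>i\<in>UNIV. \<Sum>j\<in>UNIV. if i = j then a i * b j else 0)"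
    unfolding inner_cdiag
    using assms by (intro sum.cong refl) (simp add: unitary_mat_def mat_def)
  then show ?thesis by simp
qed

lemma trace_cdiag:
  assumes "unitary_mat U"
  shows "mat 1 \<bullet> cdiag U a = (\<Sum>i\<in>UNIV. a i)"
  using inner_cdiag_same[OF assms, of "\<lambda>_. 1" a] by (simp add: cdiag_1[OF assms])

text \<open>Independence of the decomposition: for a second one with \<open>V\<close> and
  \<open>m\<close>, the matrix \<open>W = cmat_adj U ** V\<close> satisfies
  \<open>(l i - m j) * W $ i $ j = 0\<close>. Its nonzero entries occur only where the eigenvalues
  agree, and there their images under \<open>f\<close> agree too, so \<open>W\<close> also
  intertwines the two images.\<close>

lemma matfun_cdiag:
  assumes U: "unitary_mat U"
  shows "matfun f (cdiag U l) = cdiag U (\<lambda>i. f (l i))"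
proof -
  have "cdiag V (\<lambda>i. f (m i)) = cdiag U (\<lambda>i. f (l i))"
    if V: "unitary_mat V" and eq: "cdiag U l = cdiag V m" for V m
  proof -
    let ?W = "cmat_adj U ** V"
    have "real_diag l ** ?W = cmat_adj U ** U ** real_diag l ** cmat_adj U ** V"
      using U by (simp add: unitary_mat_def matrix_mul_assoc)
    also have "\<dots> = cmat_adj U ** cdiag U l ** V"
      by (simp add: cdiag_def matrix_mul_assoc)
    also have "\<dots> = cmat_adj U ** V ** real_diag m ** (cmat_adj V ** V)"
      unfolding eq by (simp add: cdiag_def matrix_mul_assoc)
    also have "\<dots> = ?W ** real_diag m"
      using V by (simp add: unitary_mat_def)
    finally have *: "of_real (l i) * ?W $ i $ j = of_real (m j) * ?W $ i $ j" for i j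
      by (metis mult_real_diag_nth real_diag_mult_nth)
    have "of_real (f (l i)) * ?W $ i $ j = of_real (f (m j)) * ?W $ i $ j" for i j
      using *[of i j] by auto
    then have "real_diag (\<lambda>i. f (l i)) ** ?W = ?W ** real_diag (\<lambda>i. f (m i))"
      by (simp add: vec_eq_iff mult_real_diag_nth real_diag_mult_nth)
    then have "U ** (real_diag (\<lambda>i. f (l i)) ** ?W) ** cmat_adj V
             = U ** (?W ** real_diag (\<lambda>i. f (m i))) ** cmat_adj V"
      by simp
    also have "U ** (real_diag (\<lambda>i. f (l i)) ** ?W) ** cmat_adj V
             = cdiag U (\<lambda>i. f (l i)) ** (V ** cmat_adj V)"
      by (simp add: cdiag_def matrix_mul_assoc)
    also have "U ** (?W ** real_diag (\<lambda>i. f (m i))) ** cmat_adj V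
             = (U ** cmat_adj U) ** cdiag V (\<lambda>i. f (m i))"
      by (simp add: cdiag_def matrix_mul_assoc)
    finally show ?thesis
      using U V by (simp add: unitary_mat_def)
  qed
  note unique = this
  show ?thesis
    unfolding matfun_def
  proof (rule some_equality)
    show "\<exists>V m. unitary_mat V \<and> cdiag U l = V ** real_diag m ** cmat_adj V
        \<and> cdiag U (\<lambda>i. f (l i)) = V ** real_diag (f \<circ> m) ** cmat_adj V"
      using U by (intro exI[of _ U] exI[of _ l]) (simp add: cdiag_def o_def)
  next
    fix B
    assume "\<exists>V m. unitary_mat V \<and> cdiag U l = V ** real_diag m ** cmat_adj V
        \<and> B = V ** real_diag (f \<circ> m) ** cmat_adj V"
    then obtain V m where V: "unitary_mat V" "cdiag U l = cdiag V m" "B = cdiag V (\<lambda>i. f (m i))"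
      by (auto simp: cdiag_def o_def)
    show "B = cdiag U (\<lambda>i. f (l i))"
      using unique[OF V(1,2)] V(3) by simp
  qed
qed

section \<open>Existence of a unitary diagonalisation\<close>

definition cinner :: "complex^'n \<Rightarrow> complex^'n \<Rightarrow> complex" where
  "cinner x y = (\<Sum>i\<in>UNIV. cnj (x $ i) * y $ i)"

text \<open>The complex-valued product is used because \<open>\<bullet>\<close> is only its real
  part, whose vanishing is too weak to give a unitary matrix of eigenvectors.\<close>

lemma cinner_mult_vec:
  assumes "self_adjoint A"
  shows "cinner (A *v x) y = cinner x (A *v y)"
proof -
  have "cinner (A *v x) y = (\<Sum>i\<in>UNIV. \<Sum>k\<in>UNIV. cnj (A $ i $ k) * cnj (x $ k) * y $ i)"
    by (simp add: cinner_def matrix_vector_mult_def sum_distrib_right)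
  also have "\<dots> = (\<Sum>k\<in>UNIV. \<Sum>i\<in>UNIV. cnj (A $ i $ k) * cnj (x $ k) * y $ i)"
    by (rule sum.swap)
  also have "\<dots> = cinner x (A *v y)"
    using assms by (simp add: cinner_def matrix_vector_mult_def sum_distrib_left mult_ac self_adjoint_iff)
  finally show ?thesis .
qed

lemma linear_matrix_vector_mult_complex: "linear (\<lambda>x::complex^'n. (A::complex^'n^'m) *v x)"
  by (rule linearI)
     (simp_all add: vec_eq_iff matrix_vector_mult_def algebra_simps sum.distrib scaleR_sum_right)

text \<open>The next eigenvector maximises the Rayleigh quotient on the orthogonal complement of
  those already found.\<close>
lemma eigenvector_in_complement:
  fixes A :: "complex^'n^'n" and u :: "'n \<Rightarrow> complex^'n"
  assumes A: "self_adjoint A" and I: "I \<noteq> UNIV"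
    and eig: "\<And>j. j \<in> I \<Longrightarrow> A *v u j = l j *\<^sub>R u j"
  obtains x c where "A *v x = c *\<^sub>R x" "norm x = 1" "\<And>j. j \<in> I \<Longrightarrow> cinner (u j) x = 0"
proof -
  define S where "S = {x. \<forall>j\<in>I. cinner (u j) x = 0}"
  have sub: "subspace S"
    unfolding S_def subspace_def cinner_def
    by (auto simp: algebra_simps sum.distrib simp flip: scaleR_sum_right)
  have inv: "A *v x \<in> S" if "x \<in> S" for x
  proof -
    have "cinner (u j) (A *v x) = l j *\<^sub>R cinner (u j) x" if "j \<in> I" for j
      unfolding cinner_mult_vec[OF A, symmetric] eig[OF that]
      by (simp add: cinner_def scaleR_sum_right)
    with \<open>x \<in> S\<close> show ?thesis by (simp add: S_def)
  qed
  obtain i0 where i0: "i0 \<notin> I" using I by blast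
  \<comment> \<open>The rows are the conjugated eigenvectors, padded with zero rows. The zero row at
    \<open>i0\<close> makes the matrix singular, and a kernel vector is a nonzero vector of the
    complement.\<close>
  define B :: "complex^'n^'n" where "B = (\<chi> i j. if i \<in> I then cnj (u i $ j) else 0)"
  have "row i0 B = 0"
    using i0 by (simp add: row_def B_def vec_eq_iff)
  then have "det B = 0"
    by (rule det_zero_row)
  then have "\<not> invertible B"
    by (simp add: invertible_det_nz)
  then obtain z where z: "B *v z = 0" "z \<noteq> 0"
    unfolding invertible_left_inverse matrix_left_invertible_ker by blast
  have "z \<in> S"
    unfolding S_def
  proof safe
    fix j assume "j \<in> I"
    then have "cinner (u j) z = (B *v z) $ j"
      by (simp add: cinner_def matrix_vector_mult_def B_def)
    then show "cinner (u j) z = 0" using z by simp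
  qed
  let ?q = "\<lambda>x. x \<bullet> (A *v x)"
  have "closed S" by (rule closed_subspace[OF sub])
  then have "compact (sphere 0 1 \<inter> S)"
    by (rule compact_Int_closed[OF compact_sphere])
  moreover have "z /\<^sub>R norm z \<in> sphere 0 1 \<inter> S"
    using z \<open>z \<in> S\<close> sub by (simp add: subspace_scale)
  moreover have "continuous_on (sphere 0 1 \<inter> S) ?q"
    by (intro continuous_intros linear_continuous_on
          linear_conv_bounded_linear[THEN iffD1] linear_matrix_vector_mult_complex)
  ultimately obtain x where x: "x \<in> sphere 0 1 \<inter> S"
    and max: "\<And>y. y \<in> sphere 0 1 \<inter> S \<Longrightarrow> ?q y \<le> ?q x"
    using continuous_attains_sup[of "sphere 0 1 \<inter> S" ?q] by blast
  note lin = linear_matrix_vector_mult_complex[of A]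
  define c where "c = ?q x"
  have nx: "norm x = 1" and xS: "x \<in> S" using x by auto
  have bound: "?q y \<le> c * (norm y)\<^sup>2" if "y \<in> S" for y
  proof (cases "y = 0")
    case False
    let ?y = "y /\<^sub>R norm y"
    have "?y \<in> sphere 0 1 \<inter> S"
      using that sub False by (simp add: subspace_scale)
    from max[OF this] show ?thesis
      using False by (simp add: c_def linear_scale[OF lin] field_simps power2_eq_square)
  qed (simp add: linear_0[OF lin])
  \<comment> \<open>The residual of the eigenvalue equation. Moving the maximiser \<open>x\<close>
    in this direction stays in \<open>S\<close>, and maximality will force the residual to
    vanish.\<close>
  define y where "y = c *\<^sub>R x - A *v x"
  have yS: "y \<in> S"
    unfolding y_def using xS inv sub by (simp add: subspace_scale subspace_diff)
  define b where "b = c * (norm y)\<^sup>2 - ?q y"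
  have sym: "x \<bullet> (A *v y) = y \<bullet> (A *v x)"
    using A inner_mult_vec[of A x y] by (simp add: self_adjoint_def inner_commute)
  \<comment> \<open>The constant term cancels because \<open>c = ?q x\<close> and
    \<open>norm x = 1\<close>. A quadratic in \<open>t\<close> without constant term is nonnegative
    for all \<open>t\<close> only if its linear coefficient is 0.\<close>
  have "0 \<le> 2 * t * (y \<bullet> y) + t\<^sup>2 * b" for t
  proof -
    have "x + t *\<^sub>R y \<in> S"
      using xS yS sub by (simp add: subspace_add subspace_scale)
    then have "0 \<le> c * (norm (x + t *\<^sub>R y))\<^sup>2 - ?q (x + t *\<^sub>R y)"
      using bound by simp
    also have "(norm (x + t *\<^sub>R y))\<^sup>2 = 1 + 2 * t * (x \<bullet> y) + t\<^sup>2 * (norm y)\<^sup>2"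
      using nx unfolding power2_norm_eq_inner norm_eq_1
      by (simp add: inner_add_left inner_add_right inner_commute power2_eq_square)
    also have "?q (x + t *\<^sub>R y) = c + 2 * t * (y \<bullet> (A *v x)) + t\<^sup>2 * ?q y"
      by (simp add: linear_add[OF lin] linear_scale[OF lin] inner_add_left inner_add_right sym
          c_def power2_eq_square algebra_simps)
    also have "c * (1 + 2 * t * (x \<bullet> y) + t\<^sup>2 * (norm y)\<^sup>2) - (c + 2 * t * (y \<bullet> (A *v x)) + t\<^sup>2 * ?q y)
        = 2 * t * (y \<bullet> (c *\<^sub>R x - A *v x)) + t\<^sup>2 * b"
      by (simp add: b_def inner_diff_right inner_commute algebra_simps)
    finally show ?thesis by (simp add: y_def)
  qed
  note quad = this
  have "y \<bullet> y = 0"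
  proof (rule ccontr)
    assume "y \<bullet> y \<noteq> 0"
    then have pos: "y \<bullet> y > 0" by simp
    define m where "m = \<bar>b\<bar> + 1"
    have m: "m > 0" "b \<le> m" by (auto simp: m_def)
    \<comment> \<open>The minimiser of the quadratic after \<open>b\<close> is replaced by its
      positive bound \<open>m\<close>; the value there is negative whatever the sign of
      \<open>b\<close>.\<close>
    define t where "t = - (y \<bullet> y) / m"
    have "2 * t * (y \<bullet> y) + t\<^sup>2 * b \<le> 2 * t * (y \<bullet> y) + t\<^sup>2 * m"
      using m by (intro add_left_mono mult_left_mono) auto
    also have "\<dots> = - ((y \<bullet> y)\<^sup>2 / m)"
      using m by (simp add: t_def power2_eq_square field_simps)
    also have "\<dots> < 0" using pos m by simp
    finally show False using quad[of t] by simp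
  qed
  then have "A *v x = c *\<^sub>R x" by (simp add: y_def)
  with that nx xS show ?thesis by (auto simp: S_def)
qed

text \<open>Induction on \<open>I\<close> adds one eigenvector from the orthogonal complement at a
  time. Indexing by the index type of the matrix makes the family over \<open>UNIV\<close> exactly
  the columns of a square matrix.\<close>

lemma spectral_family:
  fixes A :: "complex^'n^'n"
  assumes A: "self_adjoint A"
  shows "\<exists>(u :: 'n \<Rightarrow> complex^'n) l. \<forall>i\<in>I. A *v u i = l i *\<^sub>R u i \<and> (\<forall>j\<in>I. cinner (u i) (u j) = (if i = j then 1 else 0))"
  using finite[of I]
proof (induction I rule: finite_induct)
  case empty
  then show ?case by simp
next
  case (insert k I)
  then obtain u l where ul: "\<And>i. i \<in> I \<Longrightarrow> A *v u i = l i *\<^sub>R u i"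
     "\<And>i j. i \<in> I \<Longrightarrow> j \<in> I \<Longrightarrow> cinner (u i) (u j) = (if i = j then 1 else 0)"
    by metis
  have "I \<noteq> UNIV" using insert.hyps by auto
  from eigenvector_in_complement[OF A this, of u l] ul(1) obtain x c where x: "A *v x = c *\<^sub>R x" "norm x = 1" "\<And>j. j \<in> I \<Longrightarrow> cinner (u j) x = 0"
    by metis
  have cn: "cinner y z = cnj (cinner z y)" for y z :: "complex^'n"
    by (simp add: cinner_def mult.commute)
  have x0: "cinner x (u j) = 0" if "j \<in> I" for j
    using x(3)[OF that] by (subst cn) simp
  have "cinner x x = of_real ((norm x)\<^sup>2)"
    by (simp add: cinner_def norm_vec_def L2_set_def sum_nonneg complex_norm_square mult.commute del: of_real_power)
  then have xx: "cinner x x = 1" using x by simp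
  have "\<forall>i\<in>insert k I. A *v (u(k := x)) i = (l(k := c)) i *\<^sub>R (u(k := x)) i \<and>
     (\<forall>j\<in>insert k I. cinner ((u(k := x)) i) ((u(k := x)) j) = (if i = j then 1 else 0))"
    using insert.hyps ul x x0 xx by auto
  then show ?case by blast
qed

lemma spectral_theorem:
  fixes A :: "complex^'n^'n"
  assumes A: "self_adjoint A"
  obtains U l where "unitary_mat U" "A = cdiag U l"
proof -
  obtain u :: "'n \<Rightarrow> complex^'n" and l where ul: "\<And>i. A *v u i = l i *\<^sub>R u i"
     "\<And>i j. cinner (u i) (u j) = (if i = j then 1 else 0)"
    using spectral_family[OF A, of UNIV] by (metis UNIV_I)
  define U :: "complex^'n^'n" where "U = (\<chi> i j. u j $ i)"
  have "cmat_adj U ** U = mat 1"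
    using ul(2) by (simp add: vec_eq_iff matrix_mult_nth U_def mat_def cinner_def)
  moreover from this have UU: "U ** cmat_adj U = mat 1"
    using matrix_left_right_inverse by blast
  ultimately have U: "unitary_mat U" by (simp add: unitary_mat_def)
  have "(A ** U) $ i $ j = (A *v u j) $ i" for i j
    by (simp add: matrix_mult_nth matrix_vector_mult_def U_def)
  then have "A ** U = U ** real_diag l"
    by (simp add: vec_eq_iff mult_real_diag_nth ul U_def scaleR_conv_of_real[where 'a=complex])
  then have "A ** (U ** cmat_adj U) = cdiag U l"
    by (simp add: cdiag_def matrix_mul_assoc)
  with UU U that show ?thesis by simp
qed

section \<open>Trace inequalities\<close>

text \<open>The Loewner order between \<open>A\<close> and \<open>B\<close> is expressed as
  \<open>psd (B - A)\<close>. Self-adjointness is demanded separately because the real quadratic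
  form does not see a skew-adjoint part.\<close>

definition psd :: "complex^'n^'n \<Rightarrow> bool" where
  "psd A \<longleftrightarrow> self_adjoint A \<and> (\<forall>x. 0 \<le> x \<bullet> (A *v x))"

definition posdef :: "complex^'n^'n \<Rightarrow> bool" where
  "posdef A \<longleftrightarrow> self_adjoint A \<and> (\<forall>x. x \<noteq> 0 \<longrightarrow> 0 < x \<bullet> (A *v x))"

lemma quad_cdiag:
  "x \<bullet> (cdiag U l *v x) = (\<Sum>k\<in>UNIV. l k * (cmod ((cmat_adj U *v x) $ k))\<^sup>2)"
proof -
  let ?y = "cmat_adj U *v x"
  have "(real_diag l *v y) $ k = (\<Sum>j\<in>UNIV. if k = j then of_real (l k) * y $ j else 0)" for y k
    unfolding matrix_vector_mult_def vec_lambda_beta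
    by (intro sum.cong refl) (simp add: real_diag_def)
  then have "real_diag l *v ?y = (\<chi> k. of_real (l k) * ?y $ k)"
    by (simp add: vec_eq_iff)
  moreover have "x \<bullet> (cdiag U l *v x) = ?y \<bullet> (real_diag l *v ?y)"
    using inner_mult_vec[of "cmat_adj U" x] by (simp add: cdiag_def flip: matrix_vector_mul_assoc)
  ultimately have "x \<bullet> (cdiag U l *v x) = Re (\<Sum>k\<in>UNIV. of_real (l k * (cmod (?y $ k))\<^sup>2))"
    unfolding inner_complex_vec by (simp add: complex_norm_square mult_ac del: of_real_power)
  then show ?thesis by simp
qed

lemma sum_norm_unitary:
  assumes "unitary_mat U"
  shows "(\<Sum>k\<in>UNIV. (cmod ((cmat_adj U *v x) $ k))\<^sup>2) = (norm x)\<^sup>2"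
  using quad_cdiag[of x U "\<lambda>_. 1"] by (simp add: cdiag_1[OF assms] power2_norm_eq_inner)

text \<open>The witness is the column \<open>k\<close> of \<open>U\<close>. It turns information on
  the quadratic form into information on single eigenvalues.\<close>

lemma eigenvector_cdiag:
  assumes "unitary_mat U"
  obtains x where "norm x = 1" "x \<bullet> (cdiag U l *v x) = l k"
proof -
  define x where "x = U *v axis k 1"
  have y: "cmat_adj U *v x = axis k 1"
    using assms by (simp add: x_def matrix_vector_mul_assoc unitary_mat_def)
  have eq: "(cmod ((axis k (1::complex)) $ i))\<^sup>2 = (if i = k then 1 else 0)" for i
    by (simp add: axis_def)
  have "x \<bullet> (cdiag U l *v x) = l k"
    unfolding quad_cdiag y eq by (simp add: if_distrib[of "\<lambda>c. _ * c"] cong: if_cong)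
  moreover have "(norm x)\<^sup>2 = 1"
    unfolding sum_norm_unitary[OF assms, symmetric] y eq by simp
  then have "norm x = 1"
    using norm_ge_zero[of x] by (auto simp: power2_eq_1_iff)
  ultimately show thesis using that by blast
qed

lemma psd_cdiag_iff:
  assumes "unitary_mat U"
  shows "psd (cdiag U l) \<longleftrightarrow> (\<forall>i. 0 \<le> l i)"
proof
  assume *: "psd (cdiag U l)"
  show "\<forall>i. 0 \<le> l i"
  proof
    fix i
    obtain x where "x \<bullet> (cdiag U l *v x) = l i"
      using eigenvector_cdiag[OF assms] by metis
    with * show "0 \<le> l i" by (metis psd_def)
  qed
next
  assume "\<forall>i. 0 \<le> l i"
  then show "psd (cdiag U l)"
    by (auto simp: psd_def self_adjoint_cdiag quad_cdiag intro!: sum_nonneg)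
qed

lemma posdef_cdiag_iff:
  assumes "unitary_mat U"
  shows "posdef (cdiag U l) \<longleftrightarrow> (\<forall>i. 0 < l i)"
proof
  assume *: "posdef (cdiag U l)"
  show "\<forall>i. 0 < l i"
  proof
    fix i
    obtain x where "norm x = 1" "x \<bullet> (cdiag U l *v x) = l i"
      using eigenvector_cdiag[OF assms] by metis
    with * show "0 < l i" by (metis posdef_def norm_zero zero_neq_one)
  qed
next
  assume l: "\<forall>i. 0 < l i"
  have "0 < x \<bullet> (cdiag U l *v x)" if "x \<noteq> 0" for x
  proof -
    have "(\<Sum>k\<in>UNIV. (cmod ((cmat_adj U *v x) $ k))\<^sup>2) \<noteq> 0"
      using that by (simp add: sum_norm_unitary[OF assms])
    then obtain k where "(cmod ((cmat_adj U *v x) $ k))\<^sup>2 \<noteq> 0"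
      by (meson sum.not_neutral_contains_not_neutral)
    then show ?thesis
      unfolding quad_cdiag using l
      by (intro sum_pos2[of _ k]) (auto simp: less_imp_le)
  qed
  then show "posdef (cdiag U l)"
    by (simp add: posdef_def self_adjoint_cdiag)
qed

lemma posdef_imp_psd: "posdef A \<Longrightarrow> psd A"
  unfolding posdef_def psd_def by (metis inner_zero_left less_imp_le order_refl)

lemma psd_add: "psd A \<Longrightarrow> psd B \<Longrightarrow> psd (A + B)"
  by (simp add: psd_def self_adjoint_add matrix_vector_mult_add_rdistrib inner_add_right)

lemma posdef_spectral:
  assumes "posdef A"
  obtains U l where "unitary_mat U" "A = cdiag U l" "\<And>i. 0 < l i"
  by (metis assms posdef_def posdef_cdiag_iff spectral_theorem)

lemma self_adjoint_matfun:
  assumes "self_adjoint A"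
  shows "self_adjoint (matfun f A)"
proof -
  obtain U l where "unitary_mat U" "A = cdiag U l"
    using spectral_theorem[OF assms] .
  then show ?thesis by (simp add: matfun_cdiag self_adjoint_cdiag)
qed

lemma posdef_matfun:
  assumes "self_adjoint A" "\<And>x. 0 < f x"
  shows "posdef (matfun f A)"
proof -
  obtain U l where "unitary_mat U" "A = cdiag U l"
    using spectral_theorem[OF assms(1)] .
  then show ?thesis using assms(2) by (simp add: matfun_cdiag posdef_cdiag_iff)
qed

lemma psd_matfun_diff:
  assumes "self_adjoint A" "\<And>x. f x \<le> g x"
  shows "psd (matfun g A - matfun f A)"
proof -
  obtain U l where U: "unitary_mat U" and A: "A = cdiag U l"
    using spectral_theorem[OF assms(1)] by metis
  show ?thesis
    unfolding A using assms(2) by (simp add: matfun_cdiag[OF U] cdiag_diff psd_cdiag_iff[OF U])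
qed

lemma matfun_comp:
  assumes "self_adjoint A"
  shows "matfun f (matfun g A) = matfun (\<lambda>x. f (g x)) A"
proof -
  obtain U l where "unitary_mat U" "A = cdiag U l"
    using spectral_theorem[OF assms] .
  then show ?thesis by (simp add: matfun_cdiag)
qed

lemma matfun_ident:
  assumes "self_adjoint A"
  shows "matfun (\<lambda>x. x) A = A"
proof -
  obtain U l where "unitary_mat U" "A = cdiag U l"
    using spectral_theorem[OF assms] .
  then show ?thesis by (simp add: matfun_cdiag)
qed

lemma matfun_ln_exp: "self_adjoint A \<Longrightarrow> matfun ln (matfun exp A) = A"
  by (simp add: matfun_comp matfun_ident)

text \<open>By \<open>inner_cdiag\<close> this is a sum of nonnegative weights times products of
  nonnegative eigenvalues, although \<open>A ** B\<close> itself need not be self-adjoint.\<close>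

lemma inner_psd_nonneg:
  assumes "psd A" "psd B"
  shows "0 \<le> A \<bullet> B"
proof -
  obtain U a where U: "unitary_mat U" and A: "A = cdiag U a"
    using spectral_theorem assms(1) psd_def by metis
  obtain V b where V: "unitary_mat V" and B: "B = cdiag V b"
    using spectral_theorem assms(2) psd_def by metis
  show ?thesis
    using assms unfolding A B psd_cdiag_iff[OF U] psd_cdiag_iff[OF V] inner_cdiag
    by (intro sum_nonneg mult_nonneg_nonneg) auto
qed

section \<open>Gibbs variational principle and monotonicity of the trace exponential\<close>

lemma unitary_sum_left:
  assumes "unitary_mat W"
  shows "(\<Sum>i\<in>UNIV. \<Sum>j\<in>UNIV. (cmod (W $ i $ j))\<^sup>2 * f i) = (\<Sum>i\<in>UNIV. f i)"
  by (simp add: unitary_row_sum[OF assms] flip: sum_distrib_right)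

lemma unitary_sum_right:
  assumes "unitary_mat W"
  shows "(\<Sum>i\<in>UNIV. \<Sum>j\<in>UNIV. (cmod (W $ i $ j))\<^sup>2 * f j) = (\<Sum>j\<in>UNIV. f j)"
  by (subst sum.swap) (simp add: unitary_col_sum[OF assms] flip: sum_distrib_right)

text \<open>In the two eigenbases this is a weighted sum of the scalar inequality
  \<open>1 + x \<le> exp x\<close> at \<open>x = k j - ln (a i)\<close>, multiplied by
  \<open>a i\<close>. Equality holds at \<open>T = matfun exp K\<close>, so the right-hand side is a
  maximum over \<open>T\<close>.\<close>

lemma gibbs_inequality:
  assumes T: "posdef T" and K: "self_adjoint K"
  shows "T \<bullet> K + mat 1 \<bullet> T - T \<bullet> matfun ln T \<le> mat 1 \<bullet> matfun exp K"
proof -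
  obtain U a where U: "unitary_mat U" and Ta: "T = cdiag U a" and a: "\<And>i. 0 < a i"
    using posdef_spectral[OF T] by metis
  obtain V k where V: "unitary_mat V" and Kk: "K = cdiag V k"
    using spectral_theorem[OF K] by metis
  let ?W = "cmat_adj U ** V"
  have W: "unitary_mat ?W" using U V by (rule unitary_mat_adj_mult)
  let ?w = "\<lambda>i j. (cmod (?W $ i $ j))\<^sup>2"
  have "T \<bullet> K + mat 1 \<bullet> T - T \<bullet> matfun ln T
      = (\<Sum>i\<in>UNIV. \<Sum>j\<in>UNIV. ?w i j * (a i * k j)) + (\<Sum>i\<in>UNIV. \<Sum>j\<in>UNIV. ?w i j * a i)
        - (\<Sum>i\<in>UNIV. \<Sum>j\<in>UNIV. ?w i j * (a i * ln (a i)))"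
    unfolding Ta Kk matfun_cdiag[OF U] inner_cdiag_same[OF U] trace_cdiag[OF U]
      inner_cdiag[of U a V] unitary_sum_left[OF W] by simp
  also have "\<dots> = (\<Sum>i\<in>UNIV. \<Sum>j\<in>UNIV. ?w i j * (a i * k j + a i - a i * ln (a i)))"
    by (simp add: sum.distrib sum_subtractf algebra_simps)
  also have "\<dots> \<le> (\<Sum>i\<in>UNIV. \<Sum>j\<in>UNIV. ?w i j * exp (k j))"
  proof (intro sum_mono mult_left_mono)
    fix i j
    have "a i * (1 + (k j - ln (a i))) \<le> a i * exp (k j - ln (a i))"
      using a[of i] by (intro mult_left_mono exp_ge_add_one_self) auto
    also have "\<dots> = exp (k j)" using a[of i] by (simp add: exp_diff)
    finally show "a i * k j + a i - a i * ln (a i) \<le> exp (k j)" by (simp add: algebra_simps)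
  qed auto
  also have "\<dots> = mat 1 \<bullet> matfun exp K"
    unfolding Kk matfun_cdiag[OF V] trace_cdiag[OF V] unitary_sum_right[OF W] ..
  finally show ?thesis .
qed

text \<open>The exponential is not monotone in the Loewner order, but its trace is: with
  \<open>T = matfun exp A\<close> in the Gibbs inequality for \<open>B\<close>, the surplus
  \<open>T \<bullet> (B - A)\<close> is nonnegative.\<close>

lemma trace_exp_mono:
  assumes A: "self_adjoint A" and B: "self_adjoint B" and AB: "psd (B - A)"
  shows "mat 1 \<bullet> matfun exp A \<le> mat 1 \<bullet> matfun exp B"
proof -
  define T where "T = matfun exp A"
  have T: "posdef T" unfolding T_def by (rule posdef_matfun[OF A]) simp
  have "0 \<le> T \<bullet> (B - A)" using posdef_imp_psd[OF T] AB by (rule inner_psd_nonneg)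
  then have "mat 1 \<bullet> T \<le> T \<bullet> B + mat 1 \<bullet> T - T \<bullet> matfun ln T"
    by (simp add: T_def matfun_ln_exp[OF A] inner_diff_right)
  also have "\<dots> \<le> mat 1 \<bullet> matfun exp B" using T B by (rule gibbs_inequality)
  finally show ?thesis by (simp add: T_def)
qed

section \<open>Joint convexity of the relative entropy\<close>

lemma entropy_integral:
  fixes a b :: real
  assumes a: "0 < a" and b: "0 < b"
  shows "((\<lambda>u. u * (a - b)\<^sup>2 / ((1 - u) * a + u * b)) has_integral (a * ln a - a * ln b - a + b)) {0..1}"
proof -
  let ?c = "\<lambda>u. (1 - u) * a + u * b"
  have pos: "0 < ?c u" if "u \<in> {0..1}" for u
  proof (cases "u = 0")
    case False
    then show ?thesis using that a b by (intro add_nonneg_pos mult_nonneg_nonneg) auto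
  qed (use a in simp)
  \<comment> \<open>The derivative is \<open>(b - a) * (?c u - a) / ?c u\<close>, and
    \<open>?c u - a = u * (b - a)\<close>.\<close>
  let ?F = "\<lambda>u. (b - a) * u - a * ln (?c u)"
  have "((\<lambda>u. u * (a - b)\<^sup>2 / ?c u) has_integral (?F 1 - ?F 0)) {0..1}"
  proof (rule fundamental_theorem_of_calculus)
    fix u :: real assume u: "u \<in> {0..1}"
    have "(?F has_real_derivative (b - a) - a * ((b - a) / ?c u)) (at u within {0..1})"
      by (rule derivative_eq_intros refl | use pos[OF u] in \<open>force simp: algebra_simps\<close>)+
    also have "(b - a) - a * ((b - a) / ?c u) = u * (a - b)\<^sup>2 / ?c u"
      using pos[OF u] by (simp add: field_simps power2_eq_square)
    finally show "(?F has_vector_derivative u * (a - b)\<^sup>2 / ?c u) (at u within {0..1})"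
      by (simp add: has_real_derivative_iff_has_vector_derivative)
  qed simp
  then show ?thesis by (simp add: algebra_simps)
qed

lemma continuous_on_mat:
  assumes "\<And>i j. continuous_on S (\<lambda>u. f u $ i $ j)"
  shows "continuous_on S (f :: _ \<Rightarrow> complex^'n^'m)"
proof -
  have "f = (\<lambda>u. \<chi> i j. f u $ i $ j)" by (simp add: fun_eq_iff vec_eq_iff)
  then show ?thesis
    using assms by (subst \<open>f = _\<close>) (intro continuous_on_vec_lambda)
qed

lemma continuous_on_matrix_mult:
  fixes f g :: "_ \<Rightarrow> complex^'n^'n"
  assumes "continuous_on S f" "continuous_on S g"
  shows "continuous_on S (\<lambda>u. f u ** g u)"
  unfolding matrix_matrix_mult_def
  by (intro continuous_intros assms)

lemma continuous_on_cmat_adj: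
  assumes "continuous_on S f"
  shows "continuous_on S (\<lambda>u. cmat_adj (f u))"
  unfolding cmat_adj_def
  by (intro continuous_intros assms)

lemma inner_unitary:
  fixes U V X Y :: "complex^'n^'n"
  assumes "unitary_mat U" "unitary_mat V"
  shows "(cmat_adj U ** X ** V) \<bullet> (cmat_adj U ** Y ** V) = X \<bullet> Y"
proof -
  have "(cmat_adj U ** X ** V) \<bullet> (cmat_adj U ** Y ** V)
      = X \<bullet> ((U ** cmat_adj U) ** Y ** (V ** cmat_adj V))"
    by (simp add: inner_mult_right[of "cmat_adj U ** X" V] inner_mult_left[of "cmat_adj U"] matrix_mul_assoc)
  with assms show ?thesis by (simp add: unitary_mat_def)
qed

text \<open>Each term of the integrand has the form \<open>|y|\<^sup>2 / c\<close>, which is the supremum over \<open>x\<close> of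
  \<open>2 x \<bullet> y - c |x|\<^sup>2\<close>. With one \<open>X\<close> for all terms the bound becomes linear in \<open>A\<close> and \<open>B\<close>.\<close>
lemma entropy_integrand_lower_bound:
  fixes U V X :: "complex^'n^'n" and a b :: "'n \<Rightarrow> real" and u :: real
  defines "W \<equiv> cmat_adj U ** V"
    and "Z \<equiv> cmat_adj U ** X ** V"
    and "A \<equiv> cdiag U a" and "B \<equiv> cdiag V b"
    and "c \<equiv> (\<lambda>i j. (1 - u) * a i + u * b j)"
  assumes U: "unitary_mat U" and V: "unitary_mat V" and c: "\<And>i j. c i j > 0"
  shows "(\<Sum>i\<in>UNIV. \<Sum>j\<in>UNIV. (cmod (W $ i $ j))\<^sup>2 * ((a i - b j)\<^sup>2 / c i j))
       - (2 * (X \<bullet> (A - B)) - (1 - u) * (X \<bullet> (A ** X)) - u * (X \<bullet> (X ** B)))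
     = (\<Sum>i\<in>UNIV. \<Sum>j\<in>UNIV. (cmod ((a i - b j) *\<^sub>R W $ i $ j - c i j *\<^sub>R Z $ i $ j))\<^sup>2 / c i j)"
proof -
  \<comment> \<open>In the eigenbases, left multiplication by \<open>A\<close> scales rows by
    \<open>a\<close> and right multiplication by \<open>B\<close> scales columns by
    \<open>b\<close>, so the entries of \<open>Z\<close> decouple.\<close>
  have UA: "cmat_adj U ** A = real_diag a ** cmat_adj U"
    using U by (simp add: A_def cdiag_def unitary_mat_def matrix_mul_assoc)
  have BV: "B ** V = V ** real_diag b"
    using V by (simp add: B_def cdiag_def unitary_mat_def flip: matrix_mul_assoc)
  have 1: "cmat_adj U ** (A - B) ** V = real_diag a ** W - W ** real_diag b"
  proof -
    have "cmat_adj U ** (A - B) ** V = (cmat_adj U ** A) ** V - cmat_adj U ** (B ** V)"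
      by (simp add: matrix_mult_nth vec_eq_iff matrix_mul_assoc sum_subtractf algebra_simps)
    then show ?thesis by (simp add: UA BV W_def matrix_mul_assoc)
  qed
  have 2: "cmat_adj U ** (A ** X) ** V = real_diag a ** Z"
    using UA by (simp add: Z_def matrix_mul_assoc)
  have 3: "cmat_adj U ** (X ** B) ** V = Z ** real_diag b"
    using BV by (simp add: Z_def flip: matrix_mul_assoc)
  have e1: "X \<bullet> (A - B) = (\<Sum>i\<in>UNIV. \<Sum>j\<in>UNIV. (a i - b j) * (W $ i $ j \<bullet> Z $ i $ j))"
    unfolding inner_unitary[OF U V, of X, symmetric]
    unfolding 1 Z_def[symmetric] inner_vec_def
    by (simp add: real_diag_mult_nth mult_real_diag_nth inner_complex_def algebra_simps)
  have e2: "X \<bullet> (A ** X) = (\<Sum>i\<in>UNIV. \<Sum>j\<in>UNIV. a i * (cmod (Z $ i $ j))\<^sup>2)"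
    unfolding inner_unitary[OF U V, of X, symmetric]
    unfolding 2 Z_def[symmetric] inner_vec_def
    by (simp add: real_diag_mult_nth inner_complex_def cmod_power2) (simp add: power2_eq_square algebra_simps)
  have e3: "X \<bullet> (X ** B) = (\<Sum>i\<in>UNIV. \<Sum>j\<in>UNIV. b j * (cmod (Z $ i $ j))\<^sup>2)"
    unfolding inner_unitary[OF U V, of X, symmetric]
    unfolding 3 Z_def[symmetric] inner_vec_def
    by (simp add: mult_real_diag_nth inner_complex_def cmod_power2) (simp add: power2_eq_square algebra_simps)
  \<comment> \<open>Completing the square in one entry: \<open>k\<close> is the weight
    \<open>c i j\<close>, \<open>d\<close> the difference \<open>a i - b j\<close>, and
    \<open>w\<close> the modulus of \<open>y\<close>.\<close>
  have sq: "w\<^sup>2 = (cmod y)\<^sup>2 \<Longrightarrow> (cmod (d *\<^sub>R y - k *\<^sub>R z))\<^sup>2 / k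
      = w\<^sup>2 * (d\<^sup>2 / k) - 2 * (d * (y \<bullet> z)) + k * (cmod z)\<^sup>2" if "k > 0" for y z :: complex and w d k :: real
    using that unfolding power2_norm_eq_inner
    by (simp add: inner_diff_left inner_diff_right inner_commute power2_eq_square field_simps)
  have "(\<Sum>i\<in>UNIV. \<Sum>j\<in>UNIV. (cmod (W $ i $ j))\<^sup>2 * ((a i - b j)\<^sup>2 / c i j))
       - (2 * (X \<bullet> (A - B)) - (1 - u) * (X \<bullet> (A ** X)) - u * (X \<bullet> (X ** B)))
     = (\<Sum>i\<in>UNIV. \<Sum>j\<in>UNIV. (cmod (W $ i $ j))\<^sup>2 * ((a i - b j)\<^sup>2 / c i j)
         - 2 * ((a i - b j) * (W $ i $ j \<bullet> Z $ i $ j)) + c i j * (cmod (Z $ i $ j))\<^sup>2)"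
    unfolding e1 e2 e3 by (simp add: sum.distrib sum_subtractf sum_distrib_left c_def algebra_simps)
  also have "\<dots> = (\<Sum>i\<in>UNIV. \<Sum>j\<in>UNIV. (cmod ((a i - b j) *\<^sub>R W $ i $ j - c i j *\<^sub>R Z $ i $ j))\<^sup>2 / c i j)"
    by (intro sum.cong refl) (simp add: sq[OF c refl])
  finally show ?thesis .
qed

text \<open>The scalar integral formula is applied to each pair of eigenvalues and summed with the
  weights. Unit row and column sums turn the terms in a single matrix into inner products with that
  matrix alone.\<close>

lemma relative_entropy_integral:
  fixes U V :: "complex^'n^'n"
  assumes U: "unitary_mat U" and V: "unitary_mat V" and a: "\<And>i. 0 < a i" and b: "\<And>i. 0 < b i"
  defines "A \<equiv> cdiag U a" and "B \<equiv> cdiag V b"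
  shows "((\<lambda>u. u * (\<Sum>i\<in>UNIV. \<Sum>j\<in>UNIV. (cmod ((cmat_adj U ** V) $ i $ j))\<^sup>2
             * ((a i - b j)\<^sup>2 / ((1 - u) * a i + u * b j))))
          has_integral (A \<bullet> matfun ln A - A \<bullet> matfun ln B - mat 1 \<bullet> A + mat 1 \<bullet> B)) {0..1}"
proof -
  let ?W = "cmat_adj U ** V"
  have W: "unitary_mat ?W" using U V by (rule unitary_mat_adj_mult)
  let ?w = "\<lambda>i j. (cmod (?W $ i $ j))\<^sup>2"
  have "((\<lambda>u. \<Sum>i\<in>UNIV. \<Sum>j\<in>UNIV. ?w i j * (u * (a i - b j)\<^sup>2 / ((1 - u) * a i + u * b j)))
     has_integral (\<Sum>i\<in>UNIV. \<Sum>j\<in>UNIV. ?w i j * (a i * ln (a i) - a i * ln (b j) - a i + b j))) {0..1}"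
    using a b by (intro has_integral_sum has_integral_mult_right entropy_integral) auto
  moreover have "(\<Sum>i\<in>UNIV. \<Sum>j\<in>UNIV. ?w i j * (a i * ln (a i) - a i * ln (b j) - a i + b j))
     = (\<Sum>i\<in>UNIV. \<Sum>j\<in>UNIV. ?w i j * (a i * ln (a i))) - (\<Sum>i\<in>UNIV. \<Sum>j\<in>UNIV. ?w i j * (a i * ln (b j)))
      - (\<Sum>i\<in>UNIV. \<Sum>j\<in>UNIV. ?w i j * a i) + (\<Sum>i\<in>UNIV. \<Sum>j\<in>UNIV. ?w i j * b j)"
    by (simp add: sum.distrib sum_subtractf right_diff_distrib distrib_left)
  moreover have "\<dots> = A \<bullet> matfun ln A - A \<bullet> matfun ln B - mat 1 \<bullet> A + mat 1 \<bullet> B"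
    unfolding A_def B_def matfun_cdiag[OF U] matfun_cdiag[OF V] inner_cdiag_same[OF U]
      trace_cdiag[OF U] trace_cdiag[OF V] unitary_sum_left[OF W] unitary_sum_right[OF W]
    unfolding inner_cdiag ..
  ultimately show ?thesis
    by (simp add: sum_distrib_left mult_ac)
qed

text \<open>Joint convexity as a supporting functional at \<open>(A0, B0)\<close>. Relative entropy
  is homogeneous of degree one, so the functional has no constant term, and being linear it passes
  directly through an expectation.\<close>

lemma relative_entropy_support:
  fixes A0 B0 :: "complex^'n^'n"
  assumes A0: "posdef A0" and B0: "posdef B0"
  obtains P Q where
    "\<And>A B. posdef A \<Longrightarrow> posdef B \<Longrightarrow> A \<bullet> P + B \<bullet> Q \<le> A \<bullet> matfun ln A - A \<bullet> matfun ln B"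
    "A0 \<bullet> P + B0 \<bullet> Q = A0 \<bullet> matfun ln A0 - A0 \<bullet> matfun ln B0"
proof -
  obtain U a where U: "unitary_mat U" and A0a: "A0 = cdiag U a" and a: "\<And>i. 0 < a i"
    using posdef_spectral[OF A0] by metis
  obtain V b where V: "unitary_mat V" and B0b: "B0 = cdiag V b" and b: "\<And>i. 0 < b i"
    using posdef_spectral[OF B0] by metis
  let ?W = "cmat_adj U ** V"
  have pos: "0 < (1 - u) * x + u * y" if "u \<in> {0..1}" "0 < x" "0 < y" for u x y :: real
  proof (cases "u = 0")
    case False
    then show ?thesis using that by (intro add_nonneg_pos mult_nonneg_nonneg) auto
  qed (use that in simp)
  \<comment> \<open>Chosen so that the square remainder in
    \<open>entropy_integrand_lower_bound\<close> vanishes at \<open>(A0, B0)\<close>;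
    \<open>X\<close> is the same matrix transported back to the original bases.\<close>
  define Z :: "real \<Rightarrow> complex^'n^'n" where
    "Z u = (\<chi> i j. ((a i - b j) / ((1 - u) * a i + u * b j)) *\<^sub>R ?W $ i $ j)" for u
  define X where "X u = U ** Z u ** cmat_adj V" for u
  \<comment> \<open>\<open>p u\<close> and \<open>q u\<close> represent the coefficients of
    \<open>A\<close> and \<open>B\<close> in the linear lower bound for the integrand given by
    \<open>X u\<close>, including the factor \<open>u\<close>.\<close>
  define p where "p u = u *\<^sub>R (2 *\<^sub>R X u - (1 - u) *\<^sub>R (X u ** cmat_adj (X u)))" for u
  define q where "q u = u *\<^sub>R (- 2 *\<^sub>R X u - u *\<^sub>R (cmat_adj (X u) ** X u))" for u
  have cZ: "continuous_on {0..1} Z"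
  proof (rule continuous_on_mat)
    fix i j
    have "(1 - u) * a i + u * b j \<noteq> 0" if "u \<in> {0..1}" for u
      using pos[OF that a b] by (metis less_irrefl)
    then show "continuous_on {0..1} (\<lambda>u. Z u $ i $ j)"
      unfolding Z_def vec_lambda_beta by (intro continuous_intros) auto
  qed
  have cX: "continuous_on {0..1} X"
    unfolding X_def by (intro continuous_on_matrix_mult continuous_intros cZ)
  have p: "(p has_integral integral {0..1} p) {0..1}" and q: "(q has_integral integral {0..1} q) {0..1}"
    unfolding p_def q_def
    by (intro integrable_integral integrable_continuous_real continuous_on_matrix_mult
        continuous_on_cmat_adj continuous_intros cX)+
  have lin: "A \<bullet> p u + B \<bullet> q u
     = u * (2 * (X u \<bullet> (A - B)) - (1 - u) * (X u \<bullet> (A ** X u)) - u * (X u \<bullet> (X u ** B)))"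
    for A B u
  proof -
    have "X u \<bullet> (A ** X u) = A \<bullet> (X u ** cmat_adj (X u))"
      by (subst inner_commute) (rule inner_mult_right)
    moreover have "X u \<bullet> (X u ** B) = B \<bullet> (cmat_adj (X u) ** X u)"
      by (subst inner_commute) (rule inner_mult_left)
    ultimately show ?thesis
      by (simp add: p_def q_def inner_diff_left inner_diff_right inner_commute algebra_simps)
  qed
  \<comment> \<open>The added and subtracted \<open>mat 1\<close> absorb the terms
    \<open>- mat 1 \<bullet> A + mat 1 \<bullet> B\<close> that accompany the relative entropy in
    the integral formula.\<close>
  define P where "P = integral {0..1} p + mat 1"
  define Q where "Q = integral {0..1} q - mat 1"
  have int: "((\<lambda>u. A \<bullet> p u + B \<bullet> q u) has_integral (A \<bullet> P + B \<bullet> Q - mat 1 \<bullet> A + mat 1 \<bullet> B)) {0..1}" for A B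
  proof -
    have "((\<lambda>u. A \<bullet> p u + B \<bullet> q u) has_integral (A \<bullet> integral {0..1} p + B \<bullet> integral {0..1} q)) {0..1}"
      using has_integral_linear[OF p bounded_linear_inner_right[of A]]
        has_integral_linear[OF q bounded_linear_inner_right[of B]]
      by (intro has_integral_add) (simp_all add: o_def)
    then show ?thesis
      by (simp add: P_def Q_def inner_add_right inner_diff_right inner_commute)
  qed
  show ?thesis
  proof
    fix A B :: "complex^'n^'n"
    assume A: "posdef A" and B: "posdef B"
    obtain U' a' where U': "unitary_mat U'" and Aa: "A = cdiag U' a'" and a': "\<And>i. 0 < a' i"
      using posdef_spectral[OF A] by metis
    obtain V' b' where V': "unitary_mat V'" and Bb: "B = cdiag V' b'" and b': "\<And>i. 0 < b' i"
      using posdef_spectral[OF B] by metis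
    note rel = relative_entropy_integral[where a = a' and b = b', OF U' V' a' b', folded Aa Bb]
    have "A \<bullet> P + B \<bullet> Q - mat 1 \<bullet> A + mat 1 \<bullet> B
       \<le> A \<bullet> matfun ln A - A \<bullet> matfun ln B - mat 1 \<bullet> A + mat 1 \<bullet> B"
    proof (rule has_integral_le[OF int[of A B] rel])
      fix u :: real assume u: "u \<in> {0..1}"
      have c: "0 < (1 - u) * a' i + u * b' j" for i j using pos[OF u a' b'] .
      note * = entropy_integrand_lower_bound[where X = "X u" and a = a' and b = b', OF U' V' c, folded Aa Bb]
      have "0 \<le> (\<Sum>i\<in>UNIV. \<Sum>j\<in>UNIV. (cmod ((a' i - b' j) *\<^sub>R (cmat_adj U' ** V') $ i $ j
          - ((1 - u) * a' i + u * b' j) *\<^sub>R (cmat_adj U' ** X u ** V') $ i $ j))\<^sup>2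
          / ((1 - u) * a' i + u * b' j))"
        using c by (intro sum_nonneg divide_nonneg_pos) auto
      then show "A \<bullet> p u + B \<bullet> q u \<le> u * (\<Sum>i\<in>UNIV. \<Sum>j\<in>UNIV. (cmod ((cmat_adj U' ** V') $ i $ j))\<^sup>2
             * ((a' i - b' j)\<^sup>2 / ((1 - u) * a' i + u * b' j)))"
        unfolding lin *[symmetric] using u by (intro mult_left_mono) auto
    qed
    then show "A \<bullet> P + B \<bullet> Q \<le> A \<bullet> matfun ln A - A \<bullet> matfun ln B" by simp
  next
    have eq: "A0 \<bullet> p u + B0 \<bullet> q u = u * (\<Sum>i\<in>UNIV. \<Sum>j\<in>UNIV. (cmod (?W $ i $ j))\<^sup>2
             * ((a i - b j)\<^sup>2 / ((1 - u) * a i + u * b j)))" if u: "u \<in> {0..1}" for u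
    proof -
      have c: "0 < (1 - u) * a i + u * b j" for i j using pos[OF u a b] .
      have "cmat_adj U ** X u ** V = (cmat_adj U ** U) ** Z u ** (cmat_adj V ** V)"
        by (simp add: X_def matrix_mul_assoc)
      then have Z: "cmat_adj U ** X u ** V = Z u"
        using U V by (simp add: unitary_mat_def)
      have "(a i - b j) *\<^sub>R ?W $ i $ j - ((1 - u) * a i + u * b j) *\<^sub>R (Z u) $ i $ j = 0" for i j
        using c[of i j] by (simp add: Z_def)
      then show ?thesis
        using entropy_integrand_lower_bound[where X = "X u" and a = a and b = b, OF U V c, folded A0a B0b]
        unfolding lin Z by simp
    qed
    have "A0 \<bullet> P + B0 \<bullet> Q - mat 1 \<bullet> A0 + mat 1 \<bullet> B0
       = A0 \<bullet> matfun ln A0 - A0 \<bullet> matfun ln B0 - mat 1 \<bullet> A0 + mat 1 \<bullet> B0"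
      by (rule has_integral_unique[OF has_integral_eq[OF eq int]
            relative_entropy_integral[where a = a and b = b, OF U V a b, folded A0a B0b]]) auto
    then show "A0 \<bullet> P + B0 \<bullet> Q = A0 \<bullet> matfun ln A0 - A0 \<bullet> matfun ln B0" by simp
  qed
qed

section \<open>Random matrices and Lieb's theorem\<close>

text \<open>Precomposing with the Hermitian part makes \<open>matfun f\<close> a function that is Borel on all matrices:
  outside the self-adjoint ones \<open>matfun\<close> is a choice from the empty set.\<close>
definition herm :: "complex^'n^'n \<Rightarrow> complex^'n^'n" where
  "herm A = (1/2) *\<^sub>R (A + cmat_adj A)"

lemma self_adjoint_herm: "self_adjoint (herm A)"
  by (simp add: self_adjoint_def herm_def cmat_adj_scaleR cmat_adj_add add.commute)

lemma herm_self_adjoint: "self_adjoint A \<Longrightarrow> herm A = A"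
  by (simp add: self_adjoint_def herm_def flip: scaleR_2)

text \<open>Since \<open>herm\<close> is additive and idempotent, an arbitrary shift inside it may
  be replaced by its Hermitian part.\<close>

lemma herm_herm_add: "herm (herm A + B) = herm (A + B)"
proof -
  have "herm (herm A + B) = herm (herm A) + herm B"
    by (simp add: herm_def[of "herm A + B"] herm_def[of "herm A"] herm_def[of B] cmat_adj_add
        cmat_adj_scaleR scaleR_add_right)
  then show ?thesis
    by (simp add: herm_self_adjoint self_adjoint_herm) (simp add: herm_def cmat_adj_add scaleR_add_right)
qed

lemma continuous_on_herm: "continuous_on S f \<Longrightarrow> continuous_on S (\<lambda>x. herm (f x))"
  unfolding herm_def by (intro continuous_intros continuous_on_cmat_adj)

section \<open>Measurability of the functional calculus\<close>

primrec mpow :: "complex^'n^'n \<Rightarrow> nat \<Rightarrow> complex^'n^'n" where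
  "mpow A 0 = mat 1"
| "mpow A (Suc k) = A ** mpow A k"

lemma mpow_cdiag: "unitary_mat U \<Longrightarrow> mpow (cdiag U l) k = cdiag U (\<lambda>i. l i ^ k)"
  by (induction k) (simp_all add: cdiag_1 cdiag_mult)

lemma continuous_on_mpow: "continuous_on S f \<Longrightarrow> continuous_on S (\<lambda>x. mpow (f x) k)"
  by (induction k) (simp_all add: continuous_on_matrix_mult)

lemma poly_cdiag:
  assumes U: "unitary_mat U"
  shows "(\<Sum>i\<le>n. c i *\<^sub>R mpow (cdiag U l) i) = cdiag U (\<lambda>k. \<Sum>i\<le>n. c i * l k ^ i)"
  by (induction n) (simp_all add: mpow_cdiag[OF U] cdiag_scaleR cdiag_add flip: cdiag_1[OF U])

text \<open>Continuity is used only through Weierstrass approximation: \<open>matfun f\<close> is a pointwise limit of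
  matrix polynomials.\<close>
lemma borel_measurable_matfun:
  fixes f :: "real \<Rightarrow> real"
  assumes f: "continuous_on UNIV f"
  shows "(\<lambda>A::complex^'n^'n. matfun f (herm A)) \<in> borel_measurable borel"
proof -
  \<comment> \<open>One polynomial for each interval, with error below
    \<open>1 / real (Suc k)\<close>; every fixed \<open>x\<close> lies in these intervals from some
    \<open>k\<close> on.\<close>
  have "\<exists>c n. \<forall>x\<in>{-real k..real k}. \<bar>f x - (\<Sum>i\<le>n. c i * x ^ i)\<bar> < 1 / real (Suc k)" for k :: nat
  proof -
    have "continuous_on {-real k..real k} f" using f continuous_on_subset by blast
    then obtain g where "polynomial_function g" and g: "\<forall>x\<in>{-real k..real k}. norm (f x - g x) < 1 / real (Suc k)"
      using Stone_Weierstrass_polynomial_function[of "{-real k..real k}" f "1 / real (Suc k)"] by auto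
    then obtain c n where "g = (\<lambda>x. \<Sum>i\<le>n. c i * x ^ i)"
      by (auto simp: real_polynomial_function_iff_sum simp flip: real_polynomial_function_eq)
    with g show ?thesis by auto
  qed
  then obtain c n where cn: "\<And>k x. x \<in> {-real k..real k} \<Longrightarrow> \<bar>f x - (\<Sum>i\<le>n k. c k i * x ^ i)\<bar> < 1 / real (Suc k)"
    by metis
  have lim: "(\<lambda>k. \<Sum>i\<le>n k. c k i * x ^ i) \<longlonglongrightarrow> f x" for x
  proof (rule LIM_zero_cancel, rule tendsto_0_le[OF LIMSEQ_inverse_real_of_nat, of _ 1])
    have "\<forall>\<^sub>F k in sequentially. \<bar>x\<bar> \<le> real k"
      using real_arch_simple[of "\<bar>x\<bar>"] by (meson eventually_sequentiallyI of_nat_le_iff order_trans)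
    then show "\<forall>\<^sub>F k in sequentially. norm ((\<Sum>i\<le>n k. c k i * x ^ i) - f x) \<le> norm (inverse (real (Suc k))) * 1"
    proof eventually_elim
      case (elim k)
      then have "\<bar>f x - (\<Sum>i\<le>n k. c k i * x ^ i)\<bar> < 1 / real (Suc k)" by (intro cn) auto
      then show ?case by (simp add: abs_minus_commute inverse_eq_divide)
    qed
  qed
  show ?thesis
  proof (rule borel_measurable_LIMSEQ_metric)
    show "(\<lambda>A::complex^'n^'n. \<Sum>i\<le>n k. c k i *\<^sub>R mpow (herm A) i) \<in> borel_measurable borel" for k
      by (intro borel_measurable_continuous_onI continuous_intros continuous_on_mpow continuous_on_herm)
    fix A :: "complex^'n^'n"
    obtain U l where U: "unitary_mat U" and A: "herm A = cdiag U l"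
      using spectral_theorem[OF self_adjoint_herm] .
    show "(\<lambda>k. \<Sum>i\<le>n k. c k i *\<^sub>R mpow (herm A) i) \<longlonglongrightarrow> matfun f (herm A)"
      unfolding A poly_cdiag[OF U] matfun_cdiag[OF U]
      by (intro vec_tendstoI) (auto simp only: cdiag_nth intro!: tendsto_intros lim)
  qed
qed

text \<open>The norm of the entries equals the Euclidean norm of the eigenvalues, which is at most
  their sum when they are nonnegative. The trace can thus dominate a random matrix in integrability
  arguments.\<close>

lemma norm_le_trace:
  assumes "psd A"
  shows "norm A \<le> mat 1 \<bullet> A"
proof -
  obtain U a where U: "unitary_mat U" and A: "A = cdiag U a"
    using spectral_theorem assms psd_def by metis
  have a: "0 \<le> a i" for i using assms psd_cdiag_iff[OF U] A by blast
  have "norm A = L2_set a UNIV"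
    unfolding A norm_eq_sqrt_inner inner_cdiag_same[OF U] L2_set_def by (simp add: power2_eq_square)
  also have "\<dots> \<le> (\<Sum>i\<in>UNIV. a i)" using a by (intro L2_set_le_sum)
  finally show ?thesis by (simp add: A trace_cdiag[OF U])
qed

section \<open>Expectations of random matrices and Lieb's inequality\<close>

lemma integral_linear_mat:
  fixes X :: "'a \<Rightarrow> complex^'n^'n" and g :: "complex^'n^'n \<Rightarrow> 'b::euclidean_space"
  assumes "linear g" "integrable M X"
  shows "integrable M (\<lambda>w. g (X w))" "(\<integral>w. g (X w) \<partial>M) = g (\<integral>w. X w \<partial>M)"
  using assms integrable_bounded_linear[of g M X] integral_bounded_linear[of g M X]
  by (simp_all add: linear_conv_bounded_linear)

lemma linear_quad: "linear (\<lambda>A::complex^'n^'n. x \<bullet> (A *v x))"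
proof (rule linearI)
  fix A B :: "complex^'n^'n" and c :: real
  show "x \<bullet> ((A + B) *v x) = x \<bullet> (A *v x) + x \<bullet> (B *v x)"
    by (simp add: matrix_vector_mult_add_rdistrib inner_add_right)
  have "(c *\<^sub>R A) *v x = c *\<^sub>R (A *v x)"
    by (simp add: vec_eq_iff matrix_vector_mult_def scaleR_sum_right)
  then show "x \<bullet> ((c *\<^sub>R A) *v x) = c *\<^sub>R (x \<bullet> (A *v x))" by simp
qed

lemma self_adjoint_integral:
  assumes "integrable M X" "\<And>w. w \<in> space M \<Longrightarrow> self_adjoint (X w)"
  shows "self_adjoint (integral\<^sup>L M X)"
proof -
  have "linear (cmat_adj :: complex^'n^'n \<Rightarrow> _)"
    by (rule linearI) (simp_all add: cmat_adj_add cmat_adj_scaleR)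
  then have "(\<integral>w. cmat_adj (X w) \<partial>M) = cmat_adj (\<integral>w. X w \<partial>M)"
    using assms(1) by (rule integral_linear_mat(2))
  moreover have "(\<integral>w. cmat_adj (X w) \<partial>M) = (\<integral>w. X w \<partial>M)"
    using assms(2) by (intro Bochner_Integration.integral_cong) (auto simp: self_adjoint_def)
  ultimately show ?thesis by (simp add: self_adjoint_def)
qed

lemma (in prob_space) posdef_integral:
  fixes X :: "'a \<Rightarrow> complex^'n^'n"
  assumes X: "integrable M X" and pos: "\<And>w. w \<in> space M \<Longrightarrow> posdef (X w)"
  shows "posdef (integral\<^sup>L M X)"
  unfolding posdef_def
proof safe
  show "self_adjoint (integral\<^sup>L M X)"
    using X pos by (intro self_adjoint_integral) (auto simp: posdef_def)
  fix x :: "complex^'n" assume "x \<noteq> 0"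
  have "(\<integral>w. 0 \<partial>M) < (\<integral>w. x \<bullet> (X w *v x) \<partial>M)"
    using pos \<open>x \<noteq> 0\<close>
    by (intro integral_less_AE_space integral_linear_mat[OF linear_quad X] AE_I2)
       (auto simp: posdef_def emeasure_space_1)
  then show "0 < x \<bullet> (integral\<^sup>L M X *v x)"
    by (simp add: integral_linear_mat[OF linear_quad X])
qed

text \<open>Lieb's concavity theorem in the form of Jensen's inequality. By the Gibbs variational
  principle the trace is a supremum over \<open>T\<close> of an expression that is jointly concave in \<open>T\<close> and
  \<open>Z\<close>; the supporting functional is taken at the pair of expectations.\<close>
lemma (in prob_space) trace_exp_ln_jensen:
  fixes H :: "complex^'n^'n" and Z :: "'a \<Rightarrow> complex^'n^'n"
  assumes H: "self_adjoint H" and Z: "integrable M Z"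
    and pos: "\<And>w. w \<in> space M \<Longrightarrow> posdef (Z w)"
    and meas: "(\<lambda>w. matfun ln (Z w)) \<in> borel_measurable M"
  defines "T \<equiv> \<lambda>w. matfun exp (H + matfun ln (Z w))"
  shows "integrable M (\<lambda>w. mat 1 \<bullet> T w)"
    and "(\<integral>w. mat 1 \<bullet> T w \<partial>M) \<le> mat 1 \<bullet> matfun exp (H + matfun ln (integral\<^sup>L M Z))"
proof -
  have sa: "self_adjoint (H + matfun ln (Z w))" if "w \<in> space M" for w
    using H pos[OF that] by (intro self_adjoint_add self_adjoint_matfun) (auto simp: posdef_def)
  have posT: "posdef (T w)" if "w \<in> space M" for w
    unfolding T_def by (rule posdef_matfun[OF sa[OF that]]) simp
  have "(\<lambda>w. matfun exp (herm (H + matfun ln (Z w)))) \<in> borel_measurable M"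
    by (rule measurable_compose[OF _ borel_measurable_matfun])
       (use meas in \<open>auto intro: continuous_intros\<close>)
  then have measT: "T \<in> borel_measurable M"
    by (rule measurable_cong[THEN iffD1, rotated]) (simp add: T_def herm_self_adjoint sa)
  obtain V h where V: "unitary_mat V" and Hh: "H = cdiag V h" using spectral_theorem[OF H] .
  \<comment> \<open>A crude upper bound for the eigenvalues of \<open>H\<close>. It gives
    \<open>mat 1 \<bullet> T w \<le> exp c * (mat 1 \<bullet> Z w)\<close>, so the integrability of
    \<open>Z\<close> carries over to \<open>T\<close>.\<close>
  define c where "c = (\<Sum>i\<in>UNIV. \<bar>h i\<bar>)"
  have hc: "h i \<le> c" for i
    using member_le_sum[of i UNIV "\<lambda>i. \<bar>h i\<bar>"] abs_ge_self[of "h i"] by (simp add: c_def)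
  have cH: "psd (c *\<^sub>R mat 1 - H)"
    unfolding Hh cdiag_1[OF V, symmetric] cdiag_scaleR cdiag_diff psd_cdiag_iff[OF V] using hc by simp
  have trT: "mat 1 \<bullet> T w \<le> exp c * (mat 1 \<bullet> Z w)" if w: "w \<in> space M" for w
  proof -
    obtain U z where U: "unitary_mat U" and Zz: "Z w = cdiag U z" and z: "\<And>i. 0 < z i"
      using posdef_spectral[OF pos[OF w]] by metis
    have eq: "c *\<^sub>R mat 1 + matfun ln (Z w) = cdiag U (\<lambda>i. c + ln (z i))"
      unfolding Zz matfun_cdiag[OF U] cdiag_1[OF U, symmetric] cdiag_scaleR cdiag_add by simp
    have "mat 1 \<bullet> T w \<le> mat 1 \<bullet> matfun exp (c *\<^sub>R mat 1 + matfun ln (Z w))"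
      unfolding T_def
    proof (rule trace_exp_mono[OF sa[OF w]])
      show "self_adjoint (c *\<^sub>R mat 1 + matfun ln (Z w))" unfolding eq by (rule self_adjoint_cdiag)
      show "psd (c *\<^sub>R mat 1 + matfun ln (Z w) - (H + matfun ln (Z w)))" using cH by simp
    qed
    also have "\<dots> = exp c * (mat 1 \<bullet> Z w)"
      unfolding eq
      unfolding matfun_cdiag[OF U] trace_cdiag[OF U] Zz
      using z by (simp add: exp_add sum_distrib_left)
    finally show ?thesis .
  qed
  have lin1: "linear (\<lambda>A::complex^'n^'n. B \<bullet> A)" for B
    by (rule linearI) (simp_all add: inner_add_right)
  have lin2: "linear (\<lambda>A::complex^'n^'n. A \<bullet> B)" for B
    by (rule linearI) (simp_all add: inner_add_left)
  have intT: "integrable M T"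
  proof (rule Bochner_Integration.integrable_bound[OF _ measT])
    show "integrable M (\<lambda>w. exp c * (mat 1 \<bullet> Z w))"
      using integral_linear_mat(1)[OF lin1 Z] by simp
    show "AE w in M. norm (T w) \<le> norm (exp c * (mat 1 \<bullet> Z w))"
      using norm_le_trace[OF posdef_imp_psd[OF posT]] trT by (intro AE_I2) fastforce
  qed
  show "integrable M (\<lambda>w. mat 1 \<bullet> T w)"
    using integral_linear_mat(1)[OF lin1 intT] .
  define T1 where "T1 = integral\<^sup>L M T"
  define Z1 where "Z1 = integral\<^sup>L M Z"
  have T1: "posdef T1" unfolding T1_def by (rule posdef_integral[OF intT posT])
  have Z1: "posdef Z1" unfolding Z1_def by (rule posdef_integral[OF Z pos])
  obtain P Q where PQ: "\<And>A B. posdef A \<Longrightarrow> posdef B \<Longrightarrow> A \<bullet> P + B \<bullet> Q \<le> A \<bullet> matfun ln A - A \<bullet> matfun ln B"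
    and PQ1: "T1 \<bullet> P + Z1 \<bullet> Q = T1 \<bullet> matfun ln T1 - T1 \<bullet> matfun ln Z1"
    using relative_entropy_support[OF T1 Z1] by metis
  \<comment> \<open>As \<open>matfun ln (T w) = H + matfun ln (Z w)\<close>, the entropy expression
    for \<open>T w\<close> and \<open>Z w\<close> equals \<open>T w \<bullet> H\<close>. The
    supporting functional bounds it below linearly, and the expectation of a linear expression
    depends only on \<open>T1\<close> and \<open>Z1\<close>.\<close>
  have "(\<integral>w. mat 1 \<bullet> T w \<partial>M) \<le> (\<integral>w. T w \<bullet> (H + mat 1 - P) - Z w \<bullet> Q \<partial>M)"
  proof (rule integral_mono)
    show "integrable M (\<lambda>w. T w \<bullet> (H + mat 1 - P) - Z w \<bullet> Q)"
      by (intro Bochner_Integration.integrable_diff integral_linear_mat(1)[OF lin2] intT Z)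
    fix w assume w: "w \<in> space M"
    have "matfun ln (T w) = H + matfun ln (Z w)"
      unfolding T_def by (rule matfun_ln_exp[OF sa[OF w]])
    then show "mat 1 \<bullet> T w \<le> T w \<bullet> (H + mat 1 - P) - Z w \<bullet> Q"
      using PQ[OF posT[OF w] pos[OF w]]
      by (simp add: inner_add_right inner_diff_right inner_commute)
  qed (use integral_linear_mat(1)[OF lin1 intT] in auto)
  also have "\<dots> = T1 \<bullet> (H + mat 1 - P) - Z1 \<bullet> Q"
    unfolding T1_def Z1_def
    by (subst Bochner_Integration.integral_diff)
       (simp_all add: integral_linear_mat[OF lin2] intT Z)
  \<comment> \<open>Equality of the supporting functional at \<open>(T1, Z1)\<close> restores the
    entropy terms and leaves the Gibbs expression for \<open>H + matfun ln Z1\<close>.\<close>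
  also have "\<dots> = T1 \<bullet> (H + matfun ln Z1) + mat 1 \<bullet> T1 - T1 \<bullet> matfun ln T1"
    using PQ1 by (simp add: inner_add_right inner_diff_right inner_commute)
  also have "\<dots> \<le> mat 1 \<bullet> matfun exp (H + matfun ln Z1)"
    using T1 H Z1
    by (intro gibbs_inequality self_adjoint_add self_adjoint_matfun) (auto simp: posdef_def)
  finally show "(\<integral>w. mat 1 \<bullet> T w \<partial>M) \<le> mat 1 \<bullet> matfun exp (H + matfun ln (integral\<^sup>L M Z))"
    by (simp add: Z1_def)
qed

text \<open>Independence makes the joint law a product, so one summand is integrated out while the
  others are frozen in the shift, and is thereby replaced by \<open>D j\<close>. Extended
  nonnegative integrals allow Tonelli without integrability conditions.\<close>

lemma (in prob_space) nn_integral_indep_sum_le: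
  fixes G :: "'i \<Rightarrow> 'a \<Rightarrow> 'b::{real_normed_vector, second_countable_topology}" and F :: "'b \<Rightarrow> ennreal"
  assumes fin: "finite J" and indep: "indep_vars (\<lambda>_. borel) G J"
    and F: "F \<in> borel_measurable borel"
    and step: "\<And>j x. j \<in> J \<Longrightarrow> (\<integral>\<^sup>+w. F (x + G j w) \<partial>M) \<le> F (x + D j)"
  shows "(\<integral>\<^sup>+w. F (x + (\<Sum>j\<in>J. G j w)) \<partial>M) \<le> F (x + (\<Sum>j\<in>J. D j))"
  using assms
proof (induction J arbitrary: x rule: finite_induct)
  case empty
  then show ?case by (simp add: emeasure_space_1)
next
  case (insert i J)
  let ?S = "\<lambda>w. \<Sum>j\<in>J. G j w"
  have "indep_var
    borel ((\<lambda>f. \<Sum>j\<in>J. f j) \<circ> (\<lambda>w. restrict (\<lambda>j. G j w) J))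
    borel ((\<lambda>f. f i) \<circ> (\<lambda>w. restrict (\<lambda>j. G j w) {i}))"
    using insert.hyps
    by (intro indep_var_compose[OF indep_var_restrict[OF insert.prems(1)]]) auto
  also have "((\<lambda>f. \<Sum>j\<in>J. f j) \<circ> (\<lambda>w. restrict (\<lambda>j. G j w) J)) = ?S"
    by (auto simp: fun_eq_iff)
  also have "((\<lambda>f. f i) \<circ> (\<lambda>w. restrict (\<lambda>j. G j w) {i})) = G i"
    by auto
  finally have ind: "indep_var borel ?S borel (G i)" .
  note [measurable] = insert.prems(2)
  have S[measurable]: "?S \<in> borel_measurable M" and Gi[measurable]: "G i \<in> borel_measurable M"
    using indep_var_rv1[OF ind] indep_var_rv2[OF ind] by auto
  interpret Gi: prob_space "distr M borel (G i)" by (rule prob_space_distr[OF Gi])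
  have "(\<integral>\<^sup>+w. F (x + (\<Sum>j\<in>insert i J. G j w)) \<partial>M)
      = (\<integral>\<^sup>+w. (\<lambda>(s, g). F (x + s + g)) (?S w, G i w) \<partial>M)"
    using insert.hyps by (simp add: add_ac)
  also have "\<dots> = (\<integral>\<^sup>+p. (\<lambda>(s, g). F (x + s + g)) p \<partial>distr M (borel \<Otimes>\<^sub>M borel) (\<lambda>w. (?S w, G i w)))"
    by (subst nn_integral_distr) auto
  also have "\<dots> = (\<integral>\<^sup>+p. (\<lambda>(s, g). F (x + s + g)) p \<partial>(distr M borel ?S \<Otimes>\<^sub>M distr M borel (G i)))"
    using ind by (simp add: indep_var_distribution_eq)
  also have "\<dots> = (\<integral>\<^sup>+s. \<integral>\<^sup>+g. F (x + s + g) \<partial>distr M borel (G i) \<partial>distr M borel ?S)"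
    by (subst Gi.nn_integral_fst[symmetric]) auto
  also have "\<dots> = (\<integral>\<^sup>+v. \<integral>\<^sup>+w. F (x + ?S v + G i w) \<partial>M \<partial>M)"
    by (subst nn_integral_distr; simp add: nn_integral_distr)
  also have "\<dots> \<le> (\<integral>\<^sup>+v. F (x + ?S v + D i) \<partial>M)"
    by (intro nn_integral_mono insert.prems(3)) simp
  also have "\<dots> = (\<integral>\<^sup>+v. F (x + D i + ?S v) \<partial>M)"
    by (simp add: add_ac)
  \<comment> \<open>The shift has grown to \<open>x + D i\<close>, which is why the induction keeps
    \<open>x\<close> arbitrary.\<close>
  also have "\<dots> \<le> F (x + D i + (\<Sum>j\<in>J. D j))"
    using insert.prems by (intro insert.IH indep_vars_subset[OF insert.prems(1)]) auto
  also have "\<dots> = F (x + (\<Sum>j\<in>insert i J. D j))"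
    using insert.hyps by (simp add: add_ac)
  finally show ?case .
qed

section \<open>The tail bound\<close>

text \<open>The real trace of the exponential, made Borel on all matrices through
  \<open>herm\<close>, so that it can serve as the function \<open>F\<close> above with arbitrary
  shifts.\<close>

definition trexp :: "complex^'n^'n \<Rightarrow> real" where
  "trexp A = mat 1 \<bullet> matfun exp (herm A)"

lemma trexp_self_adjoint: "self_adjoint A \<Longrightarrow> trexp A = mat 1 \<bullet> matfun exp A"
  by (simp add: trexp_def herm_self_adjoint)

lemma borel_measurable_trexp [measurable]: "trexp \<in> borel_measurable borel"
  unfolding trexp_def
  by (intro borel_measurable_inner borel_measurable_const borel_measurable_matfun continuous_intros)

lemma exp_eigenvalue_le_trexp:
  assumes "unitary_mat U"
  shows "exp (l i) \<le> trexp (cdiag U l)"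
  unfolding trexp_self_adjoint[OF self_adjoint_cdiag] matfun_cdiag[OF assms] trace_cdiag[OF assms]
  by (rule member_le_sum) auto

lemma trexp_nonneg: "0 \<le> trexp A"
proof -
  obtain U l where U: "unitary_mat U" and A: "herm A = cdiag U l"
    using spectral_theorem[OF self_adjoint_herm] .
  show ?thesis unfolding trexp_def A matfun_cdiag[OF U] trace_cdiag[OF U] by (simp add: sum_nonneg)
qed

lemma trexp_mono:
  "self_adjoint A \<Longrightarrow> self_adjoint B \<Longrightarrow> psd (B - A) \<Longrightarrow> trexp A \<le> trexp B"
  by (simp add: trexp_self_adjoint trace_exp_mono)

lemma unitary_mat_1: "unitary_mat (mat 1)"
proof -
  have "cmat_adj (mat 1) = mat 1" by (simp add: vec_eq_iff mat_def)
  then show ?thesis by (simp add: unitary_mat_def)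
qed

lemma trexp_scaled_mat_1: "trexp (c *\<^sub>R (mat 1 :: complex^'n^'n)) = real CARD('n) * exp c"
proof -
  have "c *\<^sub>R (mat 1 :: complex^'n^'n) = cdiag (mat 1) (\<lambda>_. c)"
    using cdiag_scaleR[of c "mat 1" "\<lambda>_. 1"] by (simp add: cdiag_1[OF unitary_mat_1])
  then show ?thesis
    by (simp add: trexp_self_adjoint self_adjoint_cdiag matfun_cdiag unitary_mat_1 trace_cdiag)
qed

lemma bounded_linear_matrix_vector_mult_complex: "bounded_linear (\<lambda>x::complex^'n. (A::complex^'n^'n) *v x)"
  using linear_matrix_vector_mult_complex linear_conv_bounded_linear by blast

lemma psd_scaleR:
  assumes "0 \<le> c" "psd A"
  shows "psd (c *\<^sub>R A)"
proof -
  have "x \<bullet> ((c *\<^sub>R A) *v x) = c * (x \<bullet> (A *v x))" for x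
    using linear_scale[OF linear_quad[of x], of c A] by simp
  then show ?thesis using assms by (simp add: psd_def self_adjoint_scaleR)
qed

text \<open>Every eigenvalue is the quadratic form at a unit vector, hence at most the operator norm
  by Cauchy-Schwarz.\<close>

lemma psd_opnorm:
  assumes A: "self_adjoint A" and s: "opnorm A \<le> s"
  shows "psd (s *\<^sub>R mat 1 - A)"
proof -
  obtain U l where U: "unitary_mat U" and Al: "A = cdiag U l" using spectral_theorem[OF A] .
  have "l i \<le> s" for i
  proof -
    obtain x where x: "norm x = 1" "x \<bullet> (A *v x) = l i"
      using eigenvector_cdiag[OF U] Al by metis
    have "x \<bullet> (A *v x) \<le> norm x * norm (A *v x)" by (rule norm_cauchy_schwarz)
    also have "\<dots> \<le> opnorm A"
      using onorm[OF bounded_linear_matrix_vector_mult_complex, of A x] x by (simp add: opnorm_def)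
    finally show ?thesis using x s by simp
  qed
  then show ?thesis
    unfolding Al cdiag_1[OF U, symmetric] cdiag_scaleR cdiag_diff psd_cdiag_iff[OF U] by simp
qed

lemma opnorm_cdiag_le:
  assumes U: "unitary_mat U" and l: "\<And>i. \<bar>l i\<bar> \<le> s"
  shows "opnorm (cdiag U l) \<le> s"
  unfolding opnorm_def
proof (rule onorm_le)
  fix x
  have s: "0 \<le> s" using l abs_ge_zero order_trans by blast
  let ?A = "cdiag U l"
  have "(norm (?A *v x))\<^sup>2 = x \<bullet> (?A *v (?A *v x))"
    using inner_mult_vec[of ?A x] self_adjoint_cdiag[of U l]
    by (simp add: power2_norm_eq_inner self_adjoint_def)
  also have "\<dots> = (\<Sum>k\<in>UNIV. (l k)\<^sup>2 * (cmod ((cmat_adj U *v x) $ k))\<^sup>2)"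
    unfolding matrix_vector_mul_assoc cdiag_mult[OF U] quad_cdiag
    by (simp add: power2_eq_square[of "l _"])
  also have "\<dots> \<le> (\<Sum>k\<in>UNIV. s\<^sup>2 * (cmod ((cmat_adj U *v x) $ k))\<^sup>2)"
  proof (intro sum_mono mult_right_mono)
    show "(l k)\<^sup>2 \<le> s\<^sup>2" for k
      using l[of k] s by (metis abs_le_square_iff abs_of_nonneg)
  qed simp
  also have "\<dots> = (s * norm x)\<^sup>2"
    by (simp add: sum_norm_unitary[OF U] power_mult_distrib flip: sum_distrib_left)
  finally show "norm (?A *v x) \<le> s * norm x"
    by (rule power2_le_imp_le) (simp add: s)
qed

text \<open>Some eigenvalue of \<open>A\<close> has modulus at least \<open>s\<close>. Its sign
  decides which of the two exponentials has an eigenvalue of at least \<open>exp (c * s)\<close>,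
  and the trace dominates each eigenvalue.\<close>

lemma opnorm_ge_imp_trexp_ge:
  assumes A: "self_adjoint A" and s: "s \<le> opnorm A" and c: "0 < c"
  shows "exp (c * s) \<le> trexp (c *\<^sub>R A) \<or> exp (c * s) \<le> trexp (- c *\<^sub>R A)"
proof -
  obtain U l where U: "unitary_mat U" and Al: "A = cdiag U l" using spectral_theorem[OF A] .
  have "\<exists>i. s \<le> \<bar>l i\<bar>"
  proof (rule ccontr)
    assume "\<nexists>i. s \<le> \<bar>l i\<bar>"
    then have lt: "\<bar>l i\<bar> < s" for i by (meson not_le)
    \<comment> \<open>A maximum over finitely many indices turns the separate strict bounds into one
      strict bound \<open>m < s\<close>.\<close>
    define m where "m = Max (range (\<lambda>i. \<bar>l i\<bar>))"
    have "m \<in> range (\<lambda>i. \<bar>l i\<bar>)" unfolding m_def by (rule Max_in) auto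
    then have "m < s" using lt by auto
    moreover have "opnorm A \<le> m"
      unfolding Al m_def by (rule opnorm_cdiag_le[OF U]) simp
    ultimately show False using s by simp
  qed
  then obtain i where "s \<le> l i \<or> s \<le> - l i" by (auto simp: abs_real_def split: if_splits)
  then have "exp (c * s) \<le> exp (c * l i) \<or> exp (c * s) \<le> exp (- c * l i)"
    using c by auto (metis mult_le_cancel_left_pos mult_minus_right)
  then show ?thesis
    using exp_eigenvalue_le_trexp[OF U, of "\<lambda>i. c * l i" i] exp_eigenvalue_le_trexp[OF U, of "\<lambda>i. - c * l i" i]
    unfolding Al cdiag_scaleR by (auto intro: order_trans)
qed

section \<open>Moments of random matrices\<close>

lemma integrable_matI:
  fixes X :: "'a \<Rightarrow> complex^'n^'n"
  assumes X: "X \<in> borel_measurable M" and "\<And>i j. integrable M (\<lambda>w. X w $ i $ j)"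
  shows "integrable M X"
proof (rule Bochner_Integration.integrable_bound[OF _ X])
  show "integrable M (\<lambda>w. \<Sum>i\<in>UNIV. \<Sum>j\<in>UNIV. norm (X w $ i $ j))"
    using assms(2) by (intro Bochner_Integration.integrable_sum integrable_norm)
  have "norm (X w) \<le> (\<Sum>i\<in>UNIV. \<Sum>j\<in>UNIV. norm (X w $ i $ j))" for w
  proof -
    have "norm (X w) \<le> (\<Sum>i\<in>UNIV. norm (X w $ i))"
      unfolding norm_vec_def[of "X w"] by (rule L2_set_le_sum) simp
    also have "\<dots> \<le> (\<Sum>i\<in>UNIV. \<Sum>j\<in>UNIV. norm (X w $ i $ j))"
      unfolding norm_vec_def[of "X w $ _"] by (intro sum_mono L2_set_le_sum) simp
    finally show ?thesis .
  qed
  then show "AE w in M. norm (X w) \<le> norm (\<Sum>i\<in>UNIV. \<Sum>j\<in>UNIV. norm (X w $ i $ j))"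
    by (intro AE_I2) (simp add: sum_nonneg)
qed

lemma mat_expect_eq_integral:
  fixes X :: "'a \<Rightarrow> complex^'n^'n"
  assumes "integrable M X"
  shows "mat_expect M X = integral\<^sup>L M X"
proof -
  have "(\<integral>w. X w $ i $ j \<partial>M) = (\<integral>w. X w \<partial>M) $ i $ j" for i j
  proof -
    have "bounded_linear (\<lambda>A::complex^'n^'n. A $ i $ j)"
      by (rule bounded_linear_compose[OF bounded_linear_vec_nth bounded_linear_vec_nth, unfolded o_def])
    from integral_bounded_linear[OF this assms] show ?thesis .
  qed
  then show ?thesis by (simp add: mat_expect_def vec_eq_iff)
qed

text \<open>Second moments of the entries dominate everything: \<open>x \<le> 1 + x\<^sup>2\<close>
  for the entries and \<open>x * y \<le> x\<^sup>2 + y\<^sup>2\<close> for the products in the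
  square.\<close>

lemma (in prob_space) integrable_matrix_moments:
  fixes Y :: "'a \<Rightarrow> complex^'n^'n"
  assumes Y[measurable]: "Y \<in> borel_measurable M"
    and sq: "\<And>i k. integrable M (\<lambda>w. (cmod (Y w $ i $ k))\<^sup>2)"
  shows "integrable M Y" "integrable M (\<lambda>w. Y w ** Y w)"
proof -
  have [measurable]: "(\<lambda>w. Y w $ i $ j) \<in> borel_measurable M" for i j
    by (rule measurable_compose[OF Y])
       (intro borel_measurable_continuous_onI continuous_intros)
  show "integrable M Y"
  proof (rule integrable_matI[OF Y])
    fix i j
    show "integrable M (\<lambda>w. Y w $ i $ j)"
    proof (rule Bochner_Integration.integrable_bound)
      show "integrable M (\<lambda>w. 1 + (cmod (Y w $ i $ j))\<^sup>2)" using sq by simp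
      have "x \<le> 1 + x\<^sup>2" for x :: real
      proof -
        have "2 * x \<le> 1 + x\<^sup>2" using sum_squares_bound[of 1 x] by simp
        then show ?thesis using zero_le_power2[of x] by linarith
      qed
      then show "AE w in M. norm (Y w $ i $ j) \<le> norm (1 + (cmod (Y w $ i $ j))\<^sup>2)" by simp
    qed simp
  qed
  have "(\<lambda>A::complex^'n^'n. A ** A) \<in> borel_measurable borel"
    by (intro borel_measurable_continuous_onI continuous_on_matrix_mult continuous_intros)
  then have "(\<lambda>w. Y w ** Y w) \<in> borel_measurable M"
    by (rule measurable_compose[OF Y])
  then show "integrable M (\<lambda>w. Y w ** Y w)"
  proof (rule integrable_matI)
    fix i j
    have "integrable M (\<lambda>w. Y w $ i $ k * Y w $ k $ j)" for k
    proof (rule Bochner_Integration.integrable_bound)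
      show "integrable M (\<lambda>w. (cmod (Y w $ i $ k))\<^sup>2 + (cmod (Y w $ k $ j))\<^sup>2)" using sq by simp
      have "x * y \<le> x\<^sup>2 + y\<^sup>2" for x y :: real
        using sum_squares_bound[of x y] zero_le_power2[of x] zero_le_power2[of y] by linarith
      then show "AE w in M. norm (Y w $ i $ k * Y w $ k $ j)
          \<le> norm ((cmod (Y w $ i $ k))\<^sup>2 + (cmod (Y w $ k $ j))\<^sup>2)"
        by (simp add: norm_mult)
    qed simp
    then show "integrable M (\<lambda>w. (Y w ** Y w) $ i $ j)"
      by (simp add: matrix_mult_nth)
  qed
qed

section \<open>The logarithmic majorant and the Laplace transform bound\<close>

lemma one_plus_plus_square_pos: "0 < 1 + x + x\<^sup>2 / 2" for x :: real
proof -
  have "(1 + x)\<^sup>2 = 1 + 2 * x + x\<^sup>2" by (simp add: power2_sum)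
  then show ?thesis using zero_le_power2[of "1 + x"] by linarith
qed

text \<open>The scale \<open>c\<close> is a parameter because both \<open>\<theta>\<close> and
  \<open>- \<theta>\<close> will occur. The argument of \<open>ln\<close> is
  \<open>((1 + c * x)\<^sup>2 + 1) / 2\<close>, so it stays away from 0.\<close>

lemma continuous_on_log_quadratic:
  "continuous_on UNIV (\<lambda>x::real. ln (1 + c * x + (c * x)\<^sup>2 / 2))"
proof -
  have ne: "1 + c * x + (c * x)\<^sup>2 / 2 \<noteq> 0" for x
    using one_plus_plus_square_pos[of "c * x"] by linarith
  show ?thesis by (intro continuous_intros ballI ne) simp
qed

lemma matfun_quadratic:
  assumes "self_adjoint A"
  shows "matfun (\<lambda>x. 1 + c * x + (c * x)\<^sup>2 / 2) A = mat 1 + c *\<^sub>R A + (c\<^sup>2 / 2) *\<^sub>R (A ** A)"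
proof -
  obtain U l where U: "unitary_mat U" and A: "A = cdiag U l" using spectral_theorem[OF assms] .
  show ?thesis
    unfolding A matfun_cdiag[OF U] cdiag_mult[OF U] cdiag_scaleR cdiag_1[OF U, symmetric] cdiag_add
    by (simp add: power2_eq_square mult_ac)
qed

text \<open>The replacement step for a single summand: Lieb's inequality moves the expectation onto
  the quadratic \<open>Z\<close>, and \<open>ln z \<le> z - 1\<close>, applied to the eigenvalues of
  its expectation, removes the logarithm.\<close>

lemma (in prob_space) trexp_log_quadratic:
  fixes Y :: "'a \<Rightarrow> complex^'n^'n" and c :: real
  assumes Y[measurable]: "Y \<in> borel_measurable M"
    and sa: "\<And>w. w \<in> space M \<Longrightarrow> self_adjoint (Y w)"
    and sq: "\<And>i k. integrable M (\<lambda>w. (cmod (Y w $ i $ k))\<^sup>2)"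
  shows "(\<integral>\<^sup>+w. ennreal (trexp (H + matfun (\<lambda>x. ln (1 + c * x + (c * x)\<^sup>2 / 2)) (herm (Y w)))) \<partial>M)
    \<le> ennreal (trexp (H + (c *\<^sub>R mat_expect M Y + (c\<^sup>2 / 2) *\<^sub>R mat_expect M (\<lambda>w. Y w ** Y w))))"
proof -
  let ?q = "\<lambda>x. 1 + c * x + (c * x)\<^sup>2 / 2"
  let ?L = "\<lambda>w. matfun (\<lambda>x. ln (?q x)) (herm (Y w))"
  \<comment> \<open>The shift is arbitrary, but \<open>trexp\<close> depends only on Hermitian
    parts, and Lieb's inequality applies to this self-adjoint one.\<close>
  let ?K = "herm H"
  note mom = integrable_matrix_moments[OF Y sq]
  define Z where "Z w = mat 1 + c *\<^sub>R Y w + (c\<^sup>2 / 2) *\<^sub>R (Y w ** Y w)" for w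
  have Zq: "Z w = matfun ?q (Y w)" if "w \<in> space M" for w
    unfolding Z_def by (rule matfun_quadratic[OF sa[OF that], symmetric])
  have Zint: "integrable M Z"
    unfolding Z_def using mom by simp
  have EZ: "integral\<^sup>L M Z = mat 1 + c *\<^sub>R mat_expect M Y + (c\<^sup>2 / 2) *\<^sub>R mat_expect M (\<lambda>w. Y w ** Y w)"
    unfolding Z_def mat_expect_eq_integral[OF mom(1)] mat_expect_eq_integral[OF mom(2)]
    using mom by (simp add: prob_space)
  have pos: "posdef (Z w)" if "w \<in> space M" for w
    unfolding Zq[OF that] by (rule posdef_matfun[OF sa[OF that] one_plus_plus_square_pos])
  have lnZ: "matfun ln (Z w) = ?L w" if "w \<in> space M" for w
    unfolding Zq[OF that] by (simp add: matfun_comp sa[OF that] herm_self_adjoint)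
  have "?L \<in> borel_measurable M"
    by (rule measurable_compose[OF Y borel_measurable_matfun[OF continuous_on_log_quadratic]])
  then have meas: "(\<lambda>w. matfun ln (Z w)) \<in> borel_measurable M"
    by (rule measurable_cong[THEN iffD2, rotated]) (rule lnZ)
  note K = self_adjoint_herm[of H]
  have saL: "self_adjoint (?L w)" for w
    by (rule self_adjoint_matfun[OF self_adjoint_herm])
  have eq: "trexp (H + ?L w) = mat 1 \<bullet> matfun exp (?K + matfun ln (Z w))" if "w \<in> space M" for w
  proof -
    have "trexp (H + ?L w) = trexp (?K + ?L w)" by (simp add: trexp_def herm_herm_add)
    then show ?thesis
      by (simp add: lnZ[OF that] trexp_self_adjoint self_adjoint_add K saL)
  qed
  note jensen = trace_exp_ln_jensen[OF K Zint pos meas]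
  have Z1: "posdef (integral\<^sup>L M Z)" by (rule posdef_integral[OF Zint pos])
  have "(\<integral>\<^sup>+w. ennreal (trexp (H + ?L w)) \<partial>M) = (\<integral>\<^sup>+w. ennreal (mat 1 \<bullet> matfun exp (?K + matfun ln (Z w))) \<partial>M)"
    by (intro nn_integral_cong) (simp add: eq)
  also have "\<dots> = ennreal (\<integral>w. mat 1 \<bullet> matfun exp (?K + matfun ln (Z w)) \<partial>M)"
    using jensen(1) eq trexp_nonneg by (intro nn_integral_eq_integral AE_I2) (auto simp flip: eq)
  also have "\<dots> \<le> ennreal (mat 1 \<bullet> matfun exp (?K + matfun ln (integral\<^sup>L M Z)))"
    by (intro ennreal_leI jensen(2))
  also have "mat 1 \<bullet> matfun exp (?K + matfun ln (integral\<^sup>L M Z)) \<le> mat 1 \<bullet> matfun exp (?K + (integral\<^sup>L M Z - mat 1))"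
  proof (rule trace_exp_mono)
    obtain U z where U: "unitary_mat U" and Zz: "integral\<^sup>L M Z = cdiag U z" and z: "\<And>i. 0 < z i"
      using posdef_spectral[OF Z1] by metis
    have "psd (integral\<^sup>L M Z - mat 1 - matfun ln (integral\<^sup>L M Z))"
      unfolding Zz matfun_cdiag[OF U] cdiag_1[OF U, symmetric] cdiag_diff psd_cdiag_iff[OF U]
      using ln_le_minus_one[OF z] by simp
    then show "psd (?K + (integral\<^sup>L M Z - mat 1) - (?K + matfun ln (integral\<^sup>L M Z)))" by simp
  qed (use Z1 in \<open>auto simp: posdef_def intro!: self_adjoint_add self_adjoint_diff self_adjoint_matfun K self_adjoint_mat_1\<close>)
  also have "mat 1 \<bullet> matfun exp (?K + (integral\<^sup>L M Z - mat 1)) = trexp (?K + (integral\<^sup>L M Z - mat 1))"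
    using Z1 by (subst trexp_self_adjoint) (auto simp: posdef_def intro!: self_adjoint_add self_adjoint_diff K self_adjoint_mat_1)
  also have "\<dots> = trexp (H + (integral\<^sup>L M Z - mat 1))" by (simp add: trexp_def herm_herm_add)
  finally show ?thesis by (simp add: EZ add_ac ennreal_leI)
qed

text \<open>The centring is the initial shift. Replacing all summands cancels the first moments and
  leaves \<open>c\<^sup>2 / 2\<close> times the sum of second moments, which lies below a multiple
  of \<open>mat 1\<close> by the bound on its operator norm.\<close>

lemma (in prob_space) trexp_sum_bound:
  fixes Y :: "'i \<Rightarrow> 'a \<Rightarrow> complex^'d^'d" and c \<sigma>2 :: real
  assumes J: "finite J" and indep: "indep_vars (\<lambda>_. borel) Y J"
    and sa: "\<And>j w. j \<in> J \<Longrightarrow> w \<in> space M \<Longrightarrow> self_adjoint (Y j w)"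
    and sq: "\<And>j i k. j \<in> J \<Longrightarrow> integrable M (\<lambda>w. (cmod (Y j w $ i $ k))\<^sup>2)"
    and \<sigma>2: "opnorm (\<Sum>j\<in>J. mat_expect M (\<lambda>w. Y j w ** Y j w)) \<le> \<sigma>2"
  defines "G \<equiv> \<lambda>j w. matfun (\<lambda>x. ln (1 + c * x + (c * x)\<^sup>2 / 2)) (herm (Y j w))"
  shows "(\<integral>\<^sup>+w. ennreal (trexp ((\<Sum>j\<in>J. G j w - c *\<^sub>R mat_expect M (Y j)))) \<partial>M)
     \<le> ennreal (real CARD('d) * exp (c\<^sup>2 * \<sigma>2 / 2))"
    and "(\<lambda>w. trexp ((\<Sum>j\<in>J. G j w - c *\<^sub>R mat_expect M (Y j)))) \<in> borel_measurable M"
proof -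
  let ?E1 = "\<lambda>j. mat_expect M (Y j)" and ?E2 = "\<lambda>j. mat_expect M (\<lambda>w. Y j w ** Y j w)"
  define D where "D j = c *\<^sub>R ?E1 j + (c\<^sup>2 / 2) *\<^sub>R ?E2 j" for j
  have Y[measurable]: "Y j \<in> borel_measurable M" if "j \<in> J" for j
    using indep that by (auto simp: indep_vars_def)
  note g = borel_measurable_matfun[OF continuous_on_log_quadratic]
  have indepG: "indep_vars (\<lambda>_. borel) G J"
    unfolding G_def by (rule indep_vars_compose2[OF indep g])
  have [measurable]: "G j \<in> borel_measurable M" if "j \<in> J" for j
    using indepG that by (auto simp: indep_vars_def)
  show "(\<lambda>w. trexp ((\<Sum>j\<in>J. G j w - c *\<^sub>R ?E1 j))) \<in> borel_measurable M"
    by (rule measurable_compose[OF _ borel_measurable_trexp]) simp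
  let ?H = "- (\<Sum>j\<in>J. c *\<^sub>R ?E1 j)"
  have "(\<integral>\<^sup>+w. ennreal (trexp ((\<Sum>j\<in>J. G j w - c *\<^sub>R ?E1 j))) \<partial>M)
      = (\<integral>\<^sup>+w. ennreal (trexp (?H + (\<Sum>j\<in>J. G j w))) \<partial>M)"
    by (simp add: sum_subtractf)
  also have "\<dots> \<le> ennreal (trexp (?H + (\<Sum>j\<in>J. D j)))"
    unfolding D_def G_def
    by (intro nn_integral_indep_sum_le[OF J indepG[unfolded G_def]] trexp_log_quadratic Y sa sq) auto
  also have "?H + (\<Sum>j\<in>J. D j) = (c\<^sup>2 / 2) *\<^sub>R (\<Sum>j\<in>J. ?E2 j)"
    by (simp add: D_def sum.distrib scaleR_sum_right)
  also have "trexp \<dots> \<le> trexp ((c\<^sup>2 * \<sigma>2 / 2) *\<^sub>R (mat 1 :: complex^'d^'d))"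
  proof -
    have "self_adjoint (?E2 j)" if "j \<in> J" for j
    proof -
      note mom = integrable_matrix_moments[OF Y[OF that] sq[OF that]]
      show ?thesis
        unfolding mat_expect_eq_integral[OF mom(2)]
        by (intro self_adjoint_integral mom self_adjoint_square sa that)
    qed
    then have sum: "self_adjoint (\<Sum>j\<in>J. ?E2 j)" by (rule self_adjoint_sum)
    show "trexp ((c\<^sup>2 / 2) *\<^sub>R (\<Sum>j\<in>J. ?E2 j)) \<le> trexp ((c\<^sup>2 * \<sigma>2 / 2) *\<^sub>R (mat 1 :: complex^'d^'d))"
    proof (rule trexp_mono)
      have "psd (\<sigma>2 *\<^sub>R mat 1 - (\<Sum>j\<in>J. ?E2 j))" using psd_opnorm[OF sum \<sigma>2] .
      then have "psd ((c\<^sup>2 / 2) *\<^sub>R (\<sigma>2 *\<^sub>R mat 1 - (\<Sum>j\<in>J. ?E2 j)))"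
        by (rule psd_scaleR[rotated]) simp
      then show "psd ((c\<^sup>2 * \<sigma>2 / 2) *\<^sub>R mat 1 - (c\<^sup>2 / 2) *\<^sub>R (\<Sum>j\<in>J. ?E2 j))"
        by (simp add: scaleR_diff_right)
    qed (use sum in \<open>auto intro: self_adjoint_scaleR self_adjoint_mat_1\<close>)
  qed
  also have "\<dots> = real CARD('d) * exp (c\<^sup>2 * \<sigma>2 / 2)" by (rule trexp_scaled_mat_1)
  finally show "(\<integral>\<^sup>+w. ennreal (trexp ((\<Sum>j\<in>J. G j w - c *\<^sub>R ?E1 j))) \<partial>M)
     \<le> ennreal (real CARD('d) * exp (c\<^sup>2 * \<sigma>2 / 2))"
    by (simp add: ennreal_leI)
qed

lemma (in prob_space) markov_exp:
  assumes f[measurable]: "f \<in> borel_measurable M" and nn: "\<And>w. 0 \<le> f w" and B: "0 \<le> B"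
    and le: "(\<integral>\<^sup>+w. ennreal (f w) \<partial>M) \<le> ennreal B"
  shows "measure M {w \<in> space M. exp s \<le> f w} \<le> B * exp (- s)"
proof -
  have "ennreal (exp s) * emeasure M {w \<in> space M. exp s \<le> f w}
      = (\<integral>\<^sup>+w. ennreal (exp s) * indicator {w \<in> space M. exp s \<le> f w} w \<partial>M)"
    by (simp add: nn_integral_cmult_indicator)
  also have "\<dots> \<le> (\<integral>\<^sup>+w. ennreal (f w) \<partial>M)"
    by (intro nn_integral_mono) (auto simp: indicator_def ennreal_leI)
  also note le
  finally have "exp s * measure M {w \<in> space M. exp s \<le> f w} \<le> B"
    using B by (simp add: emeasure_eq_measure flip: ennreal_mult)
  then show ?thesis by (simp add: exp_minus field_simps)
qed

section \<open>The two-sided deviation bound\<close>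

lemma matfun_scaleR:
  assumes "self_adjoint A"
  shows "matfun f (c *\<^sub>R A) = matfun (\<lambda>x. f (c * x)) A"
    and "c *\<^sub>R matfun f A = matfun (\<lambda>x. c * f x) A"
proof -
  obtain U l where U: "unitary_mat U" and A: "A = cdiag U l" using spectral_theorem[OF assms] .
  show "matfun f (c *\<^sub>R A) = matfun (\<lambda>x. f (c * x)) A" "c *\<^sub>R matfun f A = matfun (\<lambda>x. c * f x) A"
    unfolding A cdiag_scaleR matfun_cdiag[OF U] by auto
qed

lemma psd_sum: "(\<And>i. i \<in> I \<Longrightarrow> psd (f i)) \<Longrightarrow> psd (sum f I)"
proof (induction I rule: infinite_finite_induct)
  case (insert i I)
  then show ?case by (simp add: psd_add)
qed (simp_all add: psd_def self_adjoint_iff)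

text \<open>The event is covered by one event for each sign of \<open>\<theta>\<close>, and each of
  these is bounded by Markov's inequality.\<close>

lemma (in prob_space) psi_truncated_sum_tail:
  fixes Y :: "'i \<Rightarrow> 'a \<Rightarrow> complex^'d^'d" and \<psi> :: "real \<Rightarrow> real" and \<theta> \<sigma>2 s :: real
  assumes \<psi>1: "\<And>x. - ln (1 - x + x\<^sup>2 / 2) \<le> \<psi> x" and \<psi>2: "\<And>x. \<psi> x \<le> ln (1 + x + x\<^sup>2 / 2)"
    and J: "finite J" and indep: "indep_vars (\<lambda>_. borel) Y J"
    and sa: "\<And>j w. j \<in> J \<Longrightarrow> w \<in> space M \<Longrightarrow> self_adjoint (Y j w)"
    and sq: "\<And>j i k. j \<in> J \<Longrightarrow> integrable M (\<lambda>w. (cmod (Y j w $ i $ k))\<^sup>2)"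
    and \<sigma>2: "opnorm (\<Sum>j\<in>J. mat_expect M (\<lambda>w. Y j w ** Y j w)) \<le> \<sigma>2"
    and \<theta>: "0 < \<theta>"
  shows "measure M {w \<in> space M.
      s \<le> opnorm (\<Sum>j\<in>J. (1/\<theta>) *\<^sub>R matfun \<psi> (\<theta> *\<^sub>R Y j w) - mat_expect M (Y j))}
    \<le> 2 * real CARD('d) * exp (- \<theta> * s + \<theta>\<^sup>2 * \<sigma>2 / 2)"
proof -
  let ?E = "\<lambda>j. mat_expect M (Y j)"
  \<comment> \<open>A measurable majorant of \<open>trexp (c *\<^sub>R S)\<close> for
    \<open>c = \<theta>\<close> and \<open>c = - \<theta>\<close>, where \<open>S\<close> is the
    centred sum: \<open>\<psi>\<close> is replaced by the logarithm.\<close>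
  define f where "f c w = trexp ((\<Sum>j\<in>J. matfun (\<lambda>x. ln (1 + c * x + (c * x)\<^sup>2 / 2)) (herm (Y j w)) - c *\<^sub>R ?E j))" for c w
  let ?A = "\<lambda>c. {w \<in> space M. exp (\<theta> * s) \<le> f c w}"
  note bound = trexp_sum_bound[OF J indep sa sq \<sigma>2, folded f_def]
  note [measurable] = bound(2)
  have A: "measure M (?A c) \<le> real CARD('d) * exp (- \<theta> * s + \<theta>\<^sup>2 * \<sigma>2 / 2)" if "c\<^sup>2 = \<theta>\<^sup>2" for c
  proof -
    have "measure M (?A c) \<le> (real CARD('d) * exp (c\<^sup>2 * \<sigma>2 / 2)) * exp (- (\<theta> * s))"
      by (rule markov_exp[OF bound(2) _ _ bound(1)]) (auto simp: f_def trexp_nonneg)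
    also have "\<dots> = real CARD('d) * exp (- \<theta> * s + \<theta>\<^sup>2 * \<sigma>2 / 2)"
      by (simp add: that mult.assoc flip: exp_add)
    finally show ?thesis .
  qed
  have Y: "Y j \<in> borel_measurable M" if "j \<in> J" for j
    using indep that by (auto simp: indep_vars_def)
  have saE: "self_adjoint (?E j)" if "j \<in> J" for j
  proof -
    note mom = integrable_matrix_moments[OF Y[OF that] sq[OF that]]
    show ?thesis
      unfolding mat_expect_eq_integral[OF mom(1)]
      by (intro self_adjoint_integral mom sa that)
  qed
  have "{w \<in> space M. s \<le> opnorm (\<Sum>j\<in>J. (1/\<theta>) *\<^sub>R matfun \<psi> (\<theta> *\<^sub>R Y j w) - ?E j)} \<subseteq> ?A \<theta> \<union> ?A (- \<theta>)"
  proof safe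
    fix w
    assume w: "w \<in> space M" and not: "\<not> exp (\<theta> * s) \<le> f (- \<theta>) w"
    let ?S = "\<Sum>j\<in>J. (1/\<theta>) *\<^sub>R matfun \<psi> (\<theta> *\<^sub>R Y j w) - ?E j"
    assume s: "s \<le> opnorm ?S"
    have saS: "self_adjoint ?S"
      by (intro self_adjoint_sum self_adjoint_diff self_adjoint_scaleR self_adjoint_matfun sa saE w)
    have le: "trexp (c *\<^sub>R ?S) \<le> f c w" if c: "c = \<theta> \<or> c = - \<theta>" for c
      unfolding f_def
    proof (rule trexp_mono)
      show "self_adjoint (c *\<^sub>R ?S)" using saS by (rule self_adjoint_scaleR)
      show "self_adjoint (\<Sum>j\<in>J. matfun (\<lambda>x. ln (1 + c * x + (c * x)\<^sup>2 / 2)) (herm (Y j w)) - c *\<^sub>R ?E j)"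
        by (intro self_adjoint_sum self_adjoint_diff self_adjoint_scaleR self_adjoint_matfun self_adjoint_herm saE)
      \<comment> \<open>For \<open>c = \<theta>\<close> this is the upper bound on
        \<open>\<psi>\<close>; for \<open>c = - \<theta>\<close> it is the negated lower
        bound.\<close>
      have "(c / \<theta>) * \<psi> (\<theta> * x) \<le> ln (1 + c * x + (c * x)\<^sup>2 / 2)" for x
        using c \<theta> \<psi>2[of "\<theta> * x"] \<psi>1[of "\<theta> * x"] by auto
      then have "psd (matfun (\<lambda>x. ln (1 + c * x + (c * x)\<^sup>2 / 2)) (herm (Y j w)) - (c / \<theta>) *\<^sub>R matfun \<psi> (\<theta> *\<^sub>R Y j w))"
        if "j \<in> J" for j
        unfolding herm_self_adjoint[OF sa[OF that w]] matfun_scaleR[OF sa[OF that w]]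
        by (intro psd_matfun_diff sa that w)
      then have "psd (\<Sum>j\<in>J. matfun (\<lambda>x. ln (1 + c * x + (c * x)\<^sup>2 / 2)) (herm (Y j w)) - (c / \<theta>) *\<^sub>R matfun \<psi> (\<theta> *\<^sub>R Y j w))"
        by (rule psd_sum)
      then show "psd ((\<Sum>j\<in>J. matfun (\<lambda>x. ln (1 + c * x + (c * x)\<^sup>2 / 2)) (herm (Y j w)) - c *\<^sub>R ?E j) - c *\<^sub>R ?S)"
        by (simp add: scaleR_sum_right scaleR_diff_right sum_subtractf)
    qed
    from opnorm_ge_imp_trexp_ge[OF saS s \<theta>] not le[of \<theta>] le[of "- \<theta>"]
    show "exp (\<theta> * s) \<le> f \<theta> w" by auto
  qed
  then have "measure M {w \<in> space M. s \<le> opnorm (\<Sum>j\<in>J. (1/\<theta>) *\<^sub>R matfun \<psi> (\<theta> *\<^sub>R Y j w) - ?E j)}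
      \<le> measure M (?A \<theta> \<union> ?A (- \<theta>))"
    by (intro finite_measure_mono) auto
  also have "\<dots> \<le> measure M (?A \<theta>) + measure M (?A (- \<theta>))"
    by (rule measure_Un_le) auto
  \<comment> \<open>Both signs satisfy \<open>c\<^sup>2 = \<theta>\<^sup>2\<close> and so give the
    same bound, whence the factor 2.\<close>
  also have "\<dots> \<le> 2 * real CARD('d) * exp (- \<theta> * s + \<theta>\<^sup>2 * \<sigma>2 / 2)"
    using A[of \<theta>] A[of "- \<theta>"] by simp
  finally show ?thesis .
qed

theorem theorem3p1:
  fixes M :: "'a measure"
    and \<psi> :: "real \<Rightarrow> real"
    and Y :: "nat \<Rightarrow> 'a \<Rightarrow> complex^'d^'d"
    and n :: nat
    and \<sigma>2 :: real
  assumes "prob_space M"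
    and "mono \<psi>"
    and "\<And>x. - ln (1 - x + x\<^sup>2 / 2) \<le> \<psi> x"
    and "\<And>x. \<psi> x \<le> ln (1 + x + x\<^sup>2 / 2)"
    and "prob_space.indep_vars M (\<lambda>_. borel) Y {1..n}"
    and "\<And>j w. j \<in> {1..n} \<Longrightarrow> w \<in> space M \<Longrightarrow> self_adjoint (Y j w)"
    and "\<And>j i k. j \<in> {1..n} \<Longrightarrow> integrable M (\<lambda>w. (cmod (Y j w $ i $ k))\<^sup>2)"
    and "opnorm (\<Sum>j\<in>{1..n}. mat_expect M (\<lambda>w. Y j w ** Y j w)) \<le> \<sigma>2"
  shows "(\<forall>\<theta>>0. \<forall>t>0.
           measure M {w \<in> space M.
              opnorm (\<Sum>j\<in>{1..n}. (1/\<theta>) *\<^sub>R matfun \<psi> (\<theta> *\<^sub>R Y j w) - mat_expect M (Y j))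
                \<ge> t * sqrt (real n)}
           \<le> 2 * real CARD('d) * exp (- \<theta> * t * sqrt (real n) + \<theta>\<^sup>2 * \<sigma>2 / 2))
       \<and> (\<sigma>2 > 0 \<longrightarrow> (\<forall>t>0. let \<theta> = t * sqrt (real n) / \<sigma>2 in
           measure M {w \<in> space M.
              opnorm (\<Sum>j\<in>{1..n}. (1/\<theta>) *\<^sub>R matfun \<psi> (\<theta> *\<^sub>R Y j w) - mat_expect M (Y j))
                \<ge> t * sqrt (real n)}
           \<le> 2 * real CARD('d) * exp (- t\<^sup>2 / (2 * \<sigma>2 / real n))))
       \<and> (\<sigma>2 > 0 \<longrightarrow> (\<forall>t>1/2. let \<theta> = sqrt (real n) / \<sigma>2 in
           measure M {w \<in> space M.
              opnorm (\<Sum>j\<in>{1..n}. (1/\<theta>) *\<^sub>R matfun \<psi> (\<theta> *\<^sub>R Y j w) - mat_expect M (Y j))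
                \<ge> t * sqrt (real n)}
           \<le> 2 * real CARD('d) * exp (- (2 * t - 1) / (2 * \<sigma>2 / real n))))"
proof -
  interpret prob_space M by fact
  let ?P = "\<lambda>\<theta> t. measure M {w \<in> space M.
              opnorm (\<Sum>j\<in>{1..n}. (1/\<theta>) *\<^sub>R matfun \<psi> (\<theta> *\<^sub>R Y j w) - mat_expect M (Y j))
                \<ge> t * sqrt (real n)}"
  have tail: "?P \<theta> t \<le> 2 * real CARD('d) * exp (- \<theta> * t * sqrt (real n) + \<theta>\<^sup>2 * \<sigma>2 / 2)" if "\<theta> > 0" for \<theta> t
    using psi_truncated_sum_tail[OF assms(3,4) _ assms(5-8) that, of "t * sqrt (real n)"] by (simp add: mult.assoc)
  have "0 < CARD('d)" by simp
  then have CARD: "1 \<le> 2 * real CARD('d)" by linarith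
  \<comment> \<open>For \<open>n = 0\<close> the chosen \<open>\<theta>\<close> is \<open>0\<close>, and division by \<open>real n\<close> turns the exponents into \<open>0\<close>.\<close>
  have n0: "?P \<theta> t \<le> 2 * real CARD('d)" for \<theta> t
    by (rule order_trans[OF prob_le_1 CARD])
  have "?P (t * sqrt (real n) / \<sigma>2) t \<le> 2 * real CARD('d) * exp (- t\<^sup>2 / (2 * \<sigma>2 / real n))"
    if "\<sigma>2 > 0" "t > 0" for t
  proof (cases "n = 0")
    case True
    then show ?thesis using n0[of "t * sqrt (real n) / \<sigma>2" t] by simp
  next
    case False
    \<comment> \<open>The minimiser of the exponent \<open>- \<theta> * t * sqrt (real n) +
      \<theta>\<^sup>2 * \<sigma>2 / 2\<close> in \<open>\<theta>\<close>.\<close>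
    let ?\<theta> = "t * sqrt (real n) / \<sigma>2"
    have "?\<theta> > 0" using that False by simp
    moreover have "- ?\<theta> * t * sqrt (real n) + ?\<theta>\<^sup>2 * \<sigma>2 / 2 = - t\<^sup>2 / (2 * \<sigma>2 / real n)"
      using that False by (simp add: field_simps power2_eq_square)
    ultimately show ?thesis using tail[of ?\<theta> t] by simp
  qed
  moreover have "?P (sqrt (real n) / \<sigma>2) t \<le> 2 * real CARD('d) * exp (- (2 * t - 1) / (2 * \<sigma>2 / real n))"
    if "\<sigma>2 > 0" for t
  proof (cases "n = 0")
    case True
    then show ?thesis using n0[of "sqrt (real n) / \<sigma>2" t] by simp
  next
    case False
    \<comment> \<open>The value optimal for \<open>t = 1\<close>, kept for every \<open>t\<close>,
      so the exponent becomes affine in \<open>t\<close>.\<close>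
    let ?\<theta> = "sqrt (real n) / \<sigma>2"
    have "?\<theta> > 0" using that False by simp
    moreover have "- ?\<theta> * t * sqrt (real n) + ?\<theta>\<^sup>2 * \<sigma>2 / 2 = - (2 * t - 1) / (2 * \<sigma>2 / real n)"
      using that False by (simp add: field_simps power2_eq_square)
    ultimately show ?thesis using tail[of ?\<theta> t] by simp
  qed
  ultimately show ?thesis
    using tail by (simp only: Let_def) blast
qed

end
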